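(* Suppose a conservative and stable SBP-FR method (flux reconstruction with summation-by-parts operators) for a scalar conservation law $\partial_t u+\partial_x f(u)=0$ is augmented with the artificial dissipation term $$-\epsilon\,A^s\,\underline{u}=-\epsilon\left(M^{-1}D^TM\,a\,D\right)^s\underline{u}$$ on the right-hand side. Then the fully discrete scheme using an explicit Euler method as time discretisation is both conservative and stable if 1. a nodal Gauss-Legendre, a nodal Lobatto-Legendre, or a modal Legendre basis is used, 2. $\langle\underline{u},A^s\underline{u}\rangle_M>0$, which will be fulfilled for the choice $a(x)=1-x^2$ if the solution $\underline{u}$ is not constant, 3. the time step $\Delta t>0$ is small enough that $Y^2-4XZ>0$ and $-Y>0$, 4. and the strength $\epsilon>0$ is big enough. Here $$X=\Delta t\,\|A^s\underline{u}\|_M^2,\qquad Y=-2\langle\underline{u},A^s\underline{u}\rangle_M-2\Delta t\,\langle\partial_t\underline{u},A^s\underline{u}\rangle_M,\qquad Z=\Delta t\,\|\partial_t\underline{u}\|_M^2 .$$ If the other conditions are fulfilled, $\epsilon$ has to satisfy $$\epsilon\ \ge\ \epsilon_2=\frac{1}{2X}\left(-Y-\sqrt{Y^2-4XZ}\right).$$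
   Context: Setting. A one-dimensional scalar conservation law $\partial_tu+\partial_xf(u)=0$ on an interval with periodic boundary conditions. The interval is partitioned into elements, each mapped onto the reference element $[-1,1]$, where all computations are done. On each element the numerical solution is a polynomial of degree $\le N$, represented by its coefficient vector $\underline{u}$ in the chosen basis (nodal Lagrange basis at Gauss-Legendre or Lobatto-Legendre nodes, or modal basis of Legendre polynomials). Operators. $M$ is the mass matrix representing a scalar product that approximates the $L_2$ scalar product, $\langle\underline{u},\underline{v}\rangle_M=\underline{u}^TM\underline{v}$, $\|\underline{u}\|_M^2=\langle\underline{u},\underline{u}\rangle_M$. $D$ is the derivative matrix, $R$ the matrix of restriction to the boundary points $\pm1$, and $B=\mathrm{diag}(-1,1)$; they satisfy the summation-by-parts (SBP) property $MD+D^TM=R^TBR$. The function $a$ is a polynomial with $a\ge0$ on $[-1,1]$ and $a(\pm1)=0$. In $A=M^{-1}D^TM\,a\,D$ the symbol $a$ denotes the matrix of multiplication by $a$ (pointwise at the nodes for nodal bases; exact multiplication followed by $L_2$ projection for modal bases). $s\in\mathbb{N}$ is the order and $\epsilon$ the strength of the dissipation; $a$ and $s$ are fixed. Scheme. $\partial_t\underline{u}$ denotes the time derivative given by the SBP-FR semidiscretisation without artificial dissipation; this semidiscretisation is built from the operators above and numerical fluxes coupling neighbouring elements. With artificial dissipation, $\partial_t\underline{u}^\epsilon=\partial_t\underline{u}-\epsilon A^s\underline{u}$, and one explicit Euler step is $\underline{u}\mapsto\underline{u}^\epsilon_+=\underline{u}+\Delta t\,\partial_t\underline{u}^\epsilon$.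 The quantities $X,Y,Z$ are computed on each element, and they are the coefficients of the quadratic equation $\epsilon^2X+\epsilon Y+Z=0$, which is equivalent to $\|\underline{u}^\epsilon_+\|_M^2=\|\underline{u}\|_M^2+2\Delta t\,\langle\underline{u},\partial_t\underline{u}\rangle_M$; $\epsilon_2$ is its smaller root. Conservative means that the total integral of the numerical solution is preserved. The semidiscretisation is stable in the sense that $\langle\underline{u},\partial_t\underline{u}\rangle_M$ reduces to boundary terms which, by the choice of numerical flux, contribute non-positively to the rate of change of the total discrete squared norm. Stability of the fully discrete scheme means that it allows the same estimate as the semidiscretisation, i.e. the squared norm after one step is bounded by $\|\underline{u}\|_M^2+2\Delta t\,\langle\underline{u},\partial_t\underline{u}\rangle_M$ (per element).
   Formalization: Stability is claimed only for ε₂ ≤ ε ≤ ε₁ (ε₁ the larger root), since it fails for ε > ε₁; for Lobatto nodes with a=1−x², "not constant" becomes "not in span{1, P_N}", since A P_N = 0 there; the order s is taken ≥ 1, since conservation fails for s = 0. *)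

theory Defs
  imports "HOL-Analysis.Analysis" "HOL-Computational_Algebra.Polynomial"
    "Jordan_Normal_Form.Gauss_Jordan_Elimination"
begin

unbundle no vec_syntax
no_notation Inner_Product.real_inner_class.inner (infix "\<bullet>" 70)

text \<open>Polynomial bases of degree at most \<open>N\<close> on the reference element \<open>[-1,1]\<close>.
  Legendre polynomials are given by Rodrigues' formula.\<close>

definition legendre :: "nat \<Rightarrow> real poly" where
  "legendre n = Polynomial.smult (1 / (2 ^ n * fact n)) ((pderiv ^^ n) ([:-1, 0, 1:] ^ n))"

definition lagrange :: "nat \<Rightarrow> (nat \<Rightarrow> real) \<Rightarrow> nat \<Rightarrow> real poly" where
  "lagrange N x k = (\<Prod>j\<in>{..N} - {k}. Polynomial.smult (1 / (x k - x j)) [:- x j, 1:])"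

text \<open>A nodal basis carries its nodes \<open>x 0 < \<dots> < x N\<close>. They are pinned down by
  \<open>valid_basis\<close>: the Gauss nodes are the \<open>N + 1\<close> zeros of \<open>legendre (N + 1)\<close>, the Lobatto nodes
  the \<open>N + 1\<close> zeros of \<open>(1 - x^2) * legendre N'\<close>, which include both boundary points.\<close>

datatype basis =
    Gauss_Legendre "nat \<Rightarrow> real"
  | is_Lobatto: Lobatto_Legendre "nat \<Rightarrow> real"
  | Modal_Legendre

fun valid_basis :: "nat \<Rightarrow> basis \<Rightarrow> bool" where
  "valid_basis N (Gauss_Legendre x) \<longleftrightarrow>
     strict_mono_on {..N} x \<and> (\<forall>i\<le>N. poly (legendre (N + 1)) (x i) = 0)"
| "valid_basis N (Lobatto_Legendre x) \<longleftrightarrow>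
     N \<ge> 1 \<and> strict_mono_on {..N} x \<and>
     (\<forall>i\<le>N. poly ([:1, 0, -1:] * pderiv (legendre N)) (x i) = 0)"
| "valid_basis N Modal_Legendre \<longleftrightarrow> True"

fun basis_poly :: "nat \<Rightarrow> basis \<Rightarrow> nat \<Rightarrow> real poly" where
  "basis_poly N (Gauss_Legendre x) k = lagrange N x k"
| "basis_poly N (Lobatto_Legendre x) k = lagrange N x k"
| "basis_poly N Modal_Legendre k = legendre k"

definition to_poly :: "nat \<Rightarrow> basis \<Rightarrow> real vec \<Rightarrow> real poly" where
  "to_poly N b u = (\<Sum>k\<le>N. Polynomial.smult (u $ k) (basis_poly N b k))"

text \<open>Coefficient vector representing a function: interpolation at the nodes, respectively
  \<open>L\<^sub>2\<close> projection. For polynomials of degree at most \<open>N\<close> both are exact.\<close>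

fun coeffs_of :: "nat \<Rightarrow> basis \<Rightarrow> (real \<Rightarrow> real) \<Rightarrow> real vec" where
  "coeffs_of N (Gauss_Legendre x) g = vec (N + 1) (\<lambda>i. g (x i))"
| "coeffs_of N (Lobatto_Legendre x) g = vec (N + 1) (\<lambda>i. g (x i))"
| "coeffs_of N Modal_Legendre g =
     vec (N + 1) (\<lambda>i. integral {-1..1} (\<lambda>t. g t * poly (legendre i) t)
                    / integral {-1..1} (\<lambda>t. (poly (legendre i) t)\<^sup>2))"

text \<open>Nodal bases use the (interpolatory) quadrature weights as diagonal mass matrix, so for
  Lobatto nodes the scalar product only approximates the \<open>L\<^sub>2\<close> one.\<close>

definition quad_mass :: "nat \<Rightarrow> (nat \<Rightarrow> real) \<Rightarrow> real mat" where
  "quad_mass N x = mat (N + 1) (N + 1)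
     (\<lambda>(i, j). if i = j then integral {-1..1} (poly (lagrange N x i)) else 0)"

fun mass_mat :: "nat \<Rightarrow> basis \<Rightarrow> real mat" where
  "mass_mat N (Gauss_Legendre x) = quad_mass N x"
| "mass_mat N (Lobatto_Legendre x) = quad_mass N x"
| "mass_mat N Modal_Legendre = mat (N + 1) (N + 1)
     (\<lambda>(i, j). integral {-1..1} (\<lambda>t. poly (legendre i) t * poly (legendre j) t))"

definition deriv_mat :: "nat \<Rightarrow> basis \<Rightarrow> real mat" where
  "deriv_mat N b = mat (N + 1) (N + 1)
     (\<lambda>(i, j). coeffs_of N b (poly (pderiv (basis_poly N b j))) $ i)"

definition mult_mat :: "nat \<Rightarrow> basis \<Rightarrow> real poly \<Rightarrow> real mat" where
  "mult_mat N b a = mat (N + 1) (N + 1)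
     (\<lambda>(i, j). coeffs_of N b (poly (a * basis_poly N b j)) $ i)"

definition restr_mat :: "nat \<Rightarrow> basis \<Rightarrow> real mat" where
  "restr_mat N b = mat 2 (N + 1) (\<lambda>(i, j). poly (basis_poly N b j) (if i = 0 then -1 else 1))"

definition bdry_mat :: "real mat" where
  "bdry_mat = mat_of_rows_list 2 [[-1, 0], [0, 1]]"

text \<open>A standing assumption on the operators; it holds for each of the three bases, since the
  quadratures are exact up to degree \<open>2 * N - 1\<close>.\<close>

definition sbp_property :: "nat \<Rightarrow> basis \<Rightarrow> bool" where
  "sbp_property N b \<longleftrightarrow>
     mass_mat N b * deriv_mat N b + transpose_mat (deriv_mat N b) * mass_mat N b
       = transpose_mat (restr_mat N b) * bdry_mat * restr_mat N b"

definition ip_M :: "nat \<Rightarrow> basis \<Rightarrow> real vec \<Rightarrow> real vec \<Rightarrow> real" where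
  "ip_M N b u v = scalar_prod u (mass_mat N b *\<^sub>v v)"

definition norm2_M :: "nat \<Rightarrow> basis \<Rightarrow> real vec \<Rightarrow> real" where
  "norm2_M N b u = ip_M N b u u"

definition diss_mat :: "nat \<Rightarrow> basis \<Rightarrow> real poly \<Rightarrow> real mat" where
  "diss_mat N b a =
     the (mat_inverse (mass_mat N b)) * transpose_mat (deriv_mat N b) * mass_mat N b
       * mult_mat N b a * deriv_mat N b"

text \<open>An SBP-FR semidiscretisation on the elements \<open>[grid i, grid (i + 1)]\<close>, \<open>i < elems\<close>, with
  periodic coupling. The correction matrix, applied to the difference of numerical fluxes and
  restricted flux, is left general; \<open>M\<^sup>-\<^sup>1 R\<^sup>T B\<close> is the canonical one. \<open>vol_corr\<close> and \<open>surf_corr\<close>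
  are the element-local correction terms of split forms (both zero for the plain scheme), which
  are needed for stability in the nonlinear case.\<close>

record sbp_fr =
  deg :: nat
  basis :: basis
  elems :: nat
  grid :: "nat \<Rightarrow> real"
  flux :: "real \<Rightarrow> real"
  num_flux :: "real \<Rightarrow> real \<Rightarrow> real"
  corr_mat :: "real mat"
  vol_corr :: "real vec \<Rightarrow> real vec"
  surf_corr :: "real vec \<Rightarrow> real vec"

type_synonym state = "nat \<Rightarrow> real vec"

definition states :: "sbp_fr \<Rightarrow> state set" where
  "states S = {U. \<forall>i<elems S. U i \<in> carrier_vec (deg S + 1)}"

definition sbp_fr_method :: "sbp_fr \<Rightarrow> bool" where
  "sbp_fr_method S \<longleftrightarrow>
     elems S > 0 \<and> strict_mono_on {..elems S} (grid S) \<and>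
     sbp_property (deg S) (basis S) \<and>
     corr_mat S \<in> carrier_mat (deg S + 1) 2 \<and>
     (\<forall>u \<in> carrier_vec (deg S + 1).
        vol_corr S u \<in> carrier_vec (deg S + 1) \<and> surf_corr S u \<in> carrier_vec 2)"

definition jac :: "sbp_fr \<Rightarrow> nat \<Rightarrow> real" where
  "jac S i = (grid S (i + 1) - grid S i) / 2"

definition traces :: "sbp_fr \<Rightarrow> real vec \<Rightarrow> real vec" where
  "traces S u = restr_mat (deg S) (basis S) *\<^sub>v u"

definition bdry_flux :: "sbp_fr \<Rightarrow> state \<Rightarrow> nat \<Rightarrow> real vec" where
  "bdry_flux S U i =
     (let l = (i + elems S - 1) mod elems S; r = (i + 1) mod elems S in
      vec_of_list [num_flux S (traces S (U l) $ 1) (traces S (U i) $ 0),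
                   num_flux S (traces S (U i) $ 1) (traces S (U r) $ 0)])"

definition ddt :: "sbp_fr \<Rightarrow> state \<Rightarrow> state" where
  "ddt S U i =
     (let N = deg S; b = basis S; f = coeffs_of N b (\<lambda>t. flux S (poly (to_poly N b (U i)) t)) in
      (- 1 / jac S i) \<cdot>\<^sub>v
        (deriv_mat N b *\<^sub>v f + vol_corr S (U i)
          + corr_mat S *\<^sub>v (bdry_flux S U i - restr_mat N b *\<^sub>v f - surf_corr S (U i))))"

definition total_integral :: "sbp_fr \<Rightarrow> state \<Rightarrow> real" where
  "total_integral S U =
     (\<Sum>i<elems S. jac S i * integral {-1..1} (poly (to_poly (deg S) (basis S) (U i))))"

definition semi_conservative :: "sbp_fr \<Rightarrow> bool" where
  "semi_conservative S \<longleftrightarrow> (\<forall>U \<in> states S. total_integral S (ddt S U) = 0)"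

text \<open>\<open>bt\<close> is the boundary term: it depends only on the boundary values of the element and
  on the numerical fluxes there. The sum below is half the rate of change of the total
  discrete squared norm.\<close>

definition semi_stable :: "sbp_fr \<Rightarrow> bool" where
  "semi_stable S \<longleftrightarrow>
     (\<exists>bt :: real vec \<Rightarrow> real vec \<Rightarrow> real. \<forall>U \<in> states S.
        (\<forall>i<elems S. jac S i * ip_M (deg S) (basis S) (U i) (ddt S U i)
                       = bt (traces S (U i)) (bdry_flux S U i)) \<and>
        (\<Sum>i<elems S. bt (traces S (U i)) (bdry_flux S U i)) \<le> 0)"

definition diss :: "sbp_fr \<Rightarrow> real poly \<Rightarrow> nat \<Rightarrow> real vec \<Rightarrow> real vec" where
  "diss S a s u = (diss_mat (deg S) (basis S) a ^\<^sub>m s) *\<^sub>v u"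

text \<open>The strength may vary from element to element, as \<open>X\<close>, \<open>Y\<close>, \<open>Z\<close> do; a global strength is
  a constant function \<open>eps\<close>.\<close>

definition euler_step ::
    "sbp_fr \<Rightarrow> real poly \<Rightarrow> nat \<Rightarrow> real \<Rightarrow> (nat \<Rightarrow> real) \<Rightarrow> state \<Rightarrow> state" where
  "euler_step S a s dt eps U i = U i + dt \<cdot>\<^sub>v (ddt S U i - eps i \<cdot>\<^sub>v diss S a s (U i))"

definition step_conservative ::
    "sbp_fr \<Rightarrow> real poly \<Rightarrow> nat \<Rightarrow> real \<Rightarrow> (nat \<Rightarrow> real) \<Rightarrow> state \<Rightarrow> bool" where
  "step_conservative S a s dt eps U \<longleftrightarrow>
     total_integral S (euler_step S a s dt eps U) = total_integral S U"

definition step_stable_on ::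
    "sbp_fr \<Rightarrow> real poly \<Rightarrow> nat \<Rightarrow> real \<Rightarrow> (nat \<Rightarrow> real) \<Rightarrow> state \<Rightarrow> nat \<Rightarrow> bool" where
  "step_stable_on S a s dt eps U i \<longleftrightarrow>
     norm2_M (deg S) (basis S) (euler_step S a s dt eps U i)
       \<le> norm2_M (deg S) (basis S) (U i) + 2 * dt * ip_M (deg S) (basis S) (U i) (ddt S U i)"

definition step_stable ::
    "sbp_fr \<Rightarrow> real poly \<Rightarrow> nat \<Rightarrow> real \<Rightarrow> (nat \<Rightarrow> real) \<Rightarrow> state \<Rightarrow> bool" where
  "step_stable S a s dt eps U \<longleftrightarrow> (\<forall>i<elems S. step_stable_on S a s dt eps U i)"

definition quadX :: "sbp_fr \<Rightarrow> real poly \<Rightarrow> nat \<Rightarrow> real \<Rightarrow> state \<Rightarrow> nat \<Rightarrow> real" where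
  "quadX S a s dt U i = dt * norm2_M (deg S) (basis S) (diss S a s (U i))"

definition quadY :: "sbp_fr \<Rightarrow> real poly \<Rightarrow> nat \<Rightarrow> real \<Rightarrow> state \<Rightarrow> nat \<Rightarrow> real" where
  "quadY S a s dt U i =
     - 2 * ip_M (deg S) (basis S) (U i) (diss S a s (U i))
     - 2 * dt * ip_M (deg S) (basis S) (ddt S U i) (diss S a s (U i))"

definition quadZ :: "sbp_fr \<Rightarrow> real poly \<Rightarrow> nat \<Rightarrow> real \<Rightarrow> state \<Rightarrow> nat \<Rightarrow> real" where
  "quadZ S a s dt U i = dt * norm2_M (deg S) (basis S) (ddt S U i)"

definition discr :: "sbp_fr \<Rightarrow> real poly \<Rightarrow> nat \<Rightarrow> real \<Rightarrow> state \<Rightarrow> nat \<Rightarrow> real" where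
  "discr S a s dt U i = (quadY S a s dt U i)\<^sup>2 - 4 * quadX S a s dt U i * quadZ S a s dt U i"

definition eps1 :: "sbp_fr \<Rightarrow> real poly \<Rightarrow> nat \<Rightarrow> real \<Rightarrow> state \<Rightarrow> nat \<Rightarrow> real" where
  "eps1 S a s dt U i =
     1 / (2 * quadX S a s dt U i) * (- quadY S a s dt U i + sqrt (discr S a s dt U i))"

definition eps2 :: "sbp_fr \<Rightarrow> real poly \<Rightarrow> nat \<Rightarrow> real \<Rightarrow> state \<Rightarrow> nat \<Rightarrow> real" where
  "eps2 S a s dt U i =
     1 / (2 * quadX S a s dt U i) * (- quadY S a s dt U i - sqrt (discr S a s dt U i))"

end

theory Submission
  imports Defs
begin

text \<open>The Legendre polynomials are orthogonal to all polynomials of lower degree, so \<open>M\<close> is diagonal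
  with positive entries for each of the bases. Summation by parts is built into
  \<open>\<langle>u, A v\<rangle> = \<langle>D u, a D v\<rangle>\<close>: with \<open>u = 1\<close> it gives conservation, and it
  shows that \<open>A\<close> is symmetric and positive semidefinite, so that \<open>\<langle>u, A\<^sup>s u\<rangle> > 0\<close> iff
  \<open>\<langle>u, A u\<rangle> \<noteq> 0\<close>. For \<open>a = 1 - x\<^sup>2\<close> the kernel of the latter form consists of the constants,
  except that the Lobatto quadrature does not see \<open>legendre N\<close>, whose derivative vanishes at the
  interior nodes. Stability is the sign of a quadratic polynomial in the strength, which is
  non-positive exactly between its roots.\<close>

section \<open>Legendre polynomials on the reference element\<close>

text \<open>Integration as a functional on polynomials: linearity becomes plain rewriting, with no
  integrability side conditions.\<close>

definition pint :: "real poly \<Rightarrow> real" where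
  "pint p = integral {-1..1} (poly p)"

lemma poly_integrable: "poly p integrable_on {-1..1::real}"
  by (intro integrable_continuous_real continuous_intros)

lemma pint_add: "pint (p + q) = pint p + pint q"
  using integral_add[OF poly_integrable poly_integrable, of p q] by (simp add: pint_def poly_add[abs_def])

lemma pint_smult: "pint (Polynomial.smult c p) = c * pint p"
  by (simp add: pint_def poly_smult[abs_def])

lemma pint_0: "pint 0 = 0"
  by (simp add: pint_def poly_0[abs_def])

lemma pint_diff: "pint (p - q) = pint p - pint q"
  using pint_add[of p "Polynomial.smult (-1) q"] pint_smult[of "-1" q] by simp

lemma pint_sum: "pint (\<Sum>i\<in>I. f i) = (\<Sum>i\<in>I. pint (f i))"
  by (induction I rule: infinite_finite_induct) (simp_all add: pint_0 pint_add)

lemma pint_pderiv: "pint (pderiv p) = poly p 1 - poly p (-1)"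
proof -
  have "(poly (pderiv p) has_integral (poly p 1 - poly p (-1))) {-1..1}"
    by (rule fundamental_theorem_of_calculus)
       (auto simp: has_real_derivative_iff_has_vector_derivative[symmetric]
             intro: has_field_derivative_at_within)
  then show ?thesis unfolding pint_def by (rule integral_unique)
qed

lemma pint_by_parts:
  assumes "poly p 1 = 0" "poly p (-1) = 0"
  shows "pint (pderiv p * q) = - pint (p * pderiv q)"
  using pint_pderiv[of "p * q"] assms by (simp add: pderiv_mult pint_add mult.commute)

lemma pint_nonneg:
  assumes "\<And>t. t \<in> {-1..1} \<Longrightarrow> poly p t \<ge> 0"
  shows "pint p \<ge> 0"
  unfolding pint_def by (rule integral_nonneg[OF poly_integrable]) (use assms in auto)

text \<open>A continuous nonnegative function with zero integral vanishes on the whole interval,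
  whereas a nonzero polynomial has finitely many roots.\<close>

lemma pint_pos:
  assumes "\<And>t. t \<in> {-1..1} \<Longrightarrow> poly p t \<ge> 0" and "p \<noteq> 0"
  shows "pint p > 0"
proof -
  have "pint p \<noteq> 0"
  proof
    assume "pint p = 0"
    then have "\<forall>t\<in>{-1..1}. poly p t = 0"
      using integral_eq_0_iff[of "-1" 1 "poly p"] assms(1)
      by (simp add: pint_def continuous_on_poly)
    then have "{-1..1::real} \<subseteq> {t. poly p t = 0}" by auto
    from finite_subset[OF this poly_roots_finite[OF assms(2)]] show False
      using infinite_Icc[of "-1::real" 1] by simp
  qed
  with pint_nonneg[OF assms(1)] show ?thesis by simp
qed

section \<open>Rodrigues' formula and orthogonality\<close>

lemma power_dvd_pderiv:
  fixes p q :: "real poly"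
  assumes "p ^ Suc m dvd q"
  shows "p ^ m dvd pderiv q"
proof -
  from assms obtain r where "q = p ^ Suc m * r" ..
  then show ?thesis
    by (simp add: pderiv_mult pderiv_power_Suc dvd_add dvd_mult dvd_mult2 dvd_smult del: power_Suc)
       (auto intro!: dvd_add dvd_smult)
qed

text \<open>Each derivative costs at most one factor \<open>p\<close>. With
  \<open>p = x^2 - 1\<close> this makes the boundary terms vanish when Rodrigues' formula is
  integrated by parts.\<close>

lemma power_dvd_iter_pderiv: "(p :: real poly) ^ m dvd (pderiv ^^ k) (p ^ (m + k))"
proof (induction k arbitrary: m)
  case (Suc k)
  from power_dvd_pderiv[OF Suc[of "Suc m"]] show ?case by simp
qed simp

lemma degree_iter_pderiv: "degree ((pderiv ^^ k) (p :: real poly)) = degree p - k"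
  by (induction k) (simp_all add: degree_pderiv)

lemma degree_legendre: "degree (legendre n) = n"
proof -
  have "degree ([:-1, 0, 1:] ^ n :: real poly) = 2 * n"
    by (simp add: degree_power_eq)
  then show ?thesis
    by (simp add: legendre_def degree_iter_pderiv)
qed

lemma legendre_0: "legendre 0 = 1"
  by (simp add: legendre_def)

lemma legendre_nonzero: "legendre n \<noteq> 0"
  using degree_legendre[of n] legendre_0 by (cases n) auto

text \<open>Repeated integration by parts moves all \<open>k\<close> derivatives onto
  \<open>q\<close>, whose degree is too small to survive them. Fewer than \<open>n\<close>
  derivatives of \<open>(x^2 - 1)^n\<close> still contain the factor \<open>x^2 - 1\<close>, so no
  boundary terms arise.\<close>

lemma rodrigues_orthogonal:
  assumes "k \<le> n" and "degree q < k"
  shows "pint ((pderiv ^^ k) ([:-1, 0, 1:] ^ n) * q) = 0"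
  using assms
proof (induction k arbitrary: q)
  case (Suc k)
  let ?r = "(pderiv ^^ k) ([:-1, 0, 1:] ^ n) :: real poly"
  from Suc.prems have "[:-1, 0, 1:] ^ Suc (n - Suc k) dvd ?r"
    using power_dvd_iter_pderiv[of "[:-1, 0, 1:]" "n - k" k] by (simp add: Suc_diff_Suc)
  then have "[:-1, 0, 1:] dvd ?r"
    by (meson dvd_power dvd_trans zero_less_Suc)
  then have "poly ?r 1 = 0" "poly ?r (-1) = 0" by auto
  from pint_by_parts[OF this]
  have "pint ((pderiv ^^ Suc k) ([:-1, 0, 1:] ^ n) * q) = - pint (?r * pderiv q)" by simp
  also have "pint (?r * pderiv q) = 0"
  \<comment> \<open>Degrees are natural numbers, so differentiating a constant does not lower its
    degree and the induction hypothesis may be out of reach; there the derivative is simply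
    zero.\<close>
  proof (cases "degree q = 0")
    case True
    then show ?thesis by (simp add: pderiv_eq_0_iff[THEN iffD2] pint_0)
  next
    case False
    with Suc.prems show ?thesis by (intro Suc.IH) (auto simp: degree_pderiv)
  qed
  finally show ?case by simp
qed simp

lemma legendre_orthogonal_lower:
  assumes "degree q < n"
  shows "pint (legendre n * q) = 0"
  using rodrigues_orthogonal[OF order_refl assms] by (simp add: legendre_def pint_smult)

lemma legendre_orthogonal:
  assumes "i \<noteq> j"
  shows "pint (legendre i * legendre j) = 0"
  using assms legendre_orthogonal_lower[of "legendre i" j] legendre_orthogonal_lower[of "legendre j" i]
  by (auto simp: degree_legendre mult.commute neq_iff)

lemma legendre_norm_pos: "pint (legendre n * legendre n) > 0"
  by (rule pint_pos) (auto simp: legendre_nonzero)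

text \<open>There is one Legendre polynomial of each degree, so subtracting a multiple with matching
  leading coefficient lowers the degree.\<close>

lemma legendre_expansion:
  assumes "degree p \<le> N"
  shows "\<exists>c. p = (\<Sum>k\<le>N. Polynomial.smult (c k) (legendre k))"
  using assms
proof (induction N arbitrary: p)
  case 0
  then obtain c where "p = [:c:]" by (auto elim: degree_eq_zeroE)
  then show ?case by (auto simp: legendre_0 intro!: exI[of _ "\<lambda>_. c"])
next
  case (Suc N)
  let ?d = "poly.coeff p (Suc N) / lead_coeff (legendre (Suc N))"
  let ?q = "p - Polynomial.smult ?d (legendre (Suc N))"
  have "poly.coeff (legendre (Suc N)) (Suc N) \<noteq> 0"
    using legendre_nonzero[of "Suc N"] by (metis degree_legendre leading_coeff_0_iff)
  then have "poly.coeff ?q (Suc N) = 0"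
    by (simp add: degree_legendre)
  moreover have "degree ?q \<le> Suc N"
    using Suc.prems by (intro degree_diff_le) (auto simp: degree_legendre)
  ultimately have "degree ?q \<le> N"
    by (metis degree_0 le0 le_Suc_eq leading_coeff_0_iff)
  from Suc.IH[OF this] obtain c where c: "?q = (\<Sum>k\<le>N. Polynomial.smult (c k) (legendre k))" by blast
  have "p = ?q + Polynomial.smult ?d (legendre (Suc N))" by simp
  also have "\<dots> = (\<Sum>k\<le>Suc N. Polynomial.smult ((c(Suc N := ?d)) k) (legendre k))"
    unfolding c by simp
  finally show ?case by blast
qed

text \<open>A root \<open>r\<close> outside the open interval would make \<open>g (x - r) h\<^sup>2\<close> of constant sign.\<close>

lemma root_of_orthogonal_poly:
  assumes g: "\<And>t. t \<in> {-1..1} \<Longrightarrow> poly g t \<ge> 0" "g \<noteq> 0"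
    and p: "p \<noteq> 0" "poly p r = 0"
    and orth: "\<And>q. degree q < degree p \<Longrightarrow> pint (g * p * q) = 0"
  shows "-1 < r \<and> r < (1::real)"
proof -
  from p obtain h where h: "p = [:-r, 1:] * h" by (auto simp: poly_eq_0_iff_dvd)
  with p have h0: "h \<noteq> 0" by auto
  then have "degree h < degree p" unfolding h by (subst degree_mult_eq) auto
  then have 0: "pint (g * p * h) = 0" by (rule orth)
  have nz: "g * p * h \<noteq> 0" using g p h0 by simp
  have eq: "poly (g * p * h) t = (t - r) * (poly g t * (poly h t)\<^sup>2)" for t
    by (simp add: h power2_eq_square algebra_simps)
  have "\<not> r \<le> -1"
  proof
    assume "r \<le> -1"
    then have "pint (g * p * h) > 0"
      using g(1) nz by (intro pint_pos) (auto simp only: eq intro!: mult_nonneg_nonneg, auto)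
    with 0 show False by simp
  qed
  moreover have "\<not> r \<ge> 1"
  proof
    assume "r \<ge> 1"
    then have "pint (- (g * p * h)) > 0"
      using g(1) nz by (intro pint_pos) (auto simp only: poly_minus eq neg_0_le_iff_le neg_equal_0_iff_equal intro!: mult_nonpos_nonneg, auto)
    with 0 show False using pint_diff[of 0 "g * p * h"] by (simp add: pint_0)
  qed
  ultimately show ?thesis by linarith
qed

section \<open>Interpolatory quadrature\<close>

lemma poly_lagrange:
  assumes "inj_on x {..N}" "i \<le> N" "j \<le> N"
  shows "poly (lagrange N x i) (x j) = (if i = j then 1 else 0)"
proof (cases "i = j")
  case True
  have "poly (Polynomial.smult (1 / (x j - x k)) [:- x k, 1:]) (x j) = 1" if "k \<in> {..N} - {j}" for k
  proof -
    have "x j - x k \<noteq> 0" using inj_onD[OF assms(1), of j k] that assms by auto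
    then show ?thesis by (simp add: diff_divide_distrib[symmetric])
  qed
  then show ?thesis using True
    unfolding lagrange_def poly_prod by (simp add: prod.neutral)
next
  case False
  then show ?thesis using assms
    unfolding lagrange_def poly_prod by (simp, intro bexI[of _ j]) auto
qed

lemma degree_lagrange:
  assumes "i \<le> N"
  shows "degree (lagrange N x i) \<le> N"
proof -
  have "degree (lagrange N x i) \<le> sum (degree \<circ> (\<lambda>j. Polynomial.smult (1 / (x i - x j)) [:- x j, 1:])) ({..N} - {i})"
    unfolding lagrange_def by (rule degree_prod_sum_le) simp
  also have "\<dots> \<le> sum (\<lambda>_. 1) ({..N} - {i})"
    by (rule sum_mono) simp
  finally show ?thesis using assms by simp
qed

lemma lagrange_interpolation:
  assumes "inj_on x {..N}" "degree p \<le> N"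
  shows "(\<Sum>i\<le>N. Polynomial.smult (poly p (x i)) (lagrange N x i)) = p"
proof (rule poly_eqI_degree)
  show "poly (\<Sum>i\<le>N. Polynomial.smult (poly p (x i)) (lagrange N x i)) t = poly p t"
    if "t \<in> x ` {..N}" for t
    using that assms(1) by (auto simp: poly_sum poly_lagrange if_distrib cong: if_cong)
  have "degree (\<Sum>i\<le>N. Polynomial.smult (poly p (x i)) (lagrange N x i)) \<le> N"
    by (intro degree_sum_le) (auto intro: order_trans[OF degree_smult_le] degree_lagrange)
  then show "card (x ` {..N}) > degree (\<Sum>i\<le>N. Polynomial.smult (poly p (x i)) (lagrange N x i))"
    using assms(1) by (simp add: card_image)
  show "card (x ` {..N}) > degree p"
    using assms by (simp add: card_image)
qed

lemma poly_zero_at_nodes: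
  fixes p :: "real poly"
  assumes "inj_on x {..N}" "degree p \<le> N" "\<And>i. i \<le> N \<Longrightarrow> poly p (x i) = 0"
  shows "p = 0"
  using lagrange_interpolation[OF assms(1,2)] assms(3) by simp

text \<open>Divide \<open>p\<close> by the nodal polynomial \<open>\<omega>\<close>: the multiple of
  \<open>\<omega>\<close> integrates to zero and vanishes at the nodes, and the remainder is
  reproduced by interpolation. Gauss nodes allow \<open>m = N + 1\<close> (exact up to degree
  \<open>2 * N + 1\<close>), Lobatto nodes \<open>m = N - 1\<close> (up to
  \<open>2 * N - 1\<close>).\<close>

lemma quadrature_exact:
  assumes inj: "inj_on x {..N}"
    and omega: "degree \<omega> = N + 1" "\<And>i. i \<le> N \<Longrightarrow> poly \<omega> (x i) = 0"
    and orth: "\<And>q. degree q < m \<Longrightarrow> pint (\<omega> * q) = 0"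
    and p: "degree p < N + 1 + m"
  shows "pint p = (\<Sum>i\<le>N. pint (lagrange N x i) * poly p (x i))"
proof -
  define q where "q = p div \<omega>"
  define r where "r = p mod \<omega>"
  have p_eq: "p = \<omega> * q + r" by (simp add: q_def r_def)
  have w0: "\<omega> \<noteq> 0" using omega(1) by auto
  have r: "degree r \<le> N" using degree_mod_less[OF w0, of p] omega(1) by (auto simp: r_def)
  have "pint (\<omega> * q) = 0"
  proof (cases "q = 0")
    case True
    then show ?thesis by (simp add: pint_def poly_0[abs_def])
  next
    case False
    then have "degree (\<omega> * q) = N + 1 + degree q" using w0 omega(1) by (simp add: degree_mult_eq)
    \<comment> \<open>The leading terms cannot cancel, since \<open>\<omega> * q\<close> has degree
      above \<open>N\<close> and \<open>r\<close> does not. Hence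
      \<open>degree q < m\<close>.\<close>
    moreover have "degree p = degree (\<omega> * q)"
      unfolding p_eq by (rule degree_add_eq_left) (use calculation r in simp)
    ultimately show ?thesis using p by (intro orth) simp
  qed
  then have "pint p = pint r" by (simp add: p_eq pint_add)
  also have "\<dots> = (\<Sum>i\<le>N. pint (lagrange N x i) * poly r (x i))"
    by (subst lagrange_interpolation[OF inj r, symmetric]) (simp add: pint_sum pint_smult mult.commute)
  also have "\<dots> = (\<Sum>i\<le>N. pint (lagrange N x i) * poly p (x i))"
    by (intro sum.cong) (simp_all add: p_eq omega(2))
  finally show ?thesis .
qed

text \<open>Only the term of node \<open>i\<close> survives in the quadrature of \<open>p\<close>,
  and the integral of \<open>p\<close> is positive. What remains for each rule is to find such a
  \<open>p\<close> of low enough degree.\<close>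

lemma quadrature_weight_pos:
  assumes exact: "pint p = (\<Sum>j\<le>N. pint (lagrange N x j) * poly p (x j))"
    and nonneg: "\<And>t. t \<in> {-1..1} \<Longrightarrow> poly p t \<ge> 0" and "p \<noteq> 0"
    and i: "i \<le> N" "x i \<in> {-1..1}"
    and zero: "\<And>j. j \<le> N \<Longrightarrow> j \<noteq> i \<Longrightarrow> poly p (x j) = 0"
  shows "pint (lagrange N x i) > 0"
proof -
  have "pint p = (\<Sum>j\<in>{i}. pint (lagrange N x j) * poly p (x j))"
    unfolding exact by (rule sum.mono_neutral_right) (use i zero in auto)
  then have "pint (lagrange N x i) * poly p (x i) > 0"
    using pint_pos[OF nonneg \<open>p \<noteq> 0\<close>] by simp
  with nonneg[OF i(2)] show ?thesis
    by (simp add: zero_less_mult_iff)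
qed

section \<open>Nodes and positive weights of the Gauss and Lobatto rules\<close>

lemma gauss_nodes:
  assumes "valid_basis N (Gauss_Legendre x)" "i \<le> N"
  shows "-1 < x i" "x i < 1"
proof -
  have "-1 < x i \<and> x i < 1"
    by (rule root_of_orthogonal_poly[where g = 1 and p = "legendre (N + 1)"])
       (use assms in \<open>auto simp: legendre_nonzero degree_legendre legendre_orthogonal_lower\<close>)
  then show "-1 < x i" "x i < 1" by auto
qed

text \<open>The test polynomial is the square of the nodal polynomial with the factor of node
  \<open>i\<close> removed; its degree \<open>2 * N\<close> is within the exactness of the Gauss
  rule.\<close>

lemma gauss_weight_pos:
  assumes b: "valid_basis N (Gauss_Legendre x)" and i: "i \<le> N"
  shows "pint (lagrange N x i) > 0"
proof -
  have inj: "inj_on x {..N}" and root: "\<And>i. i \<le> N \<Longrightarrow> poly (legendre (N + 1)) (x i) = 0"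
    using b by (auto dest: strict_mono_on_imp_inj_on)
  from root[OF i] obtain h where h: "legendre (N + 1) = [:- x i, 1:] * h"
    by (auto simp: poly_eq_0_iff_dvd)
  then have h0: "h \<noteq> 0" using legendre_nonzero[of "N + 1"] by auto
  have "degree (legendre (N + 1)) = 1 + degree h"
    unfolding h using h0 by (subst degree_mult_eq) auto
  then have deg: "degree h = N" by (simp add: degree_legendre)
  show ?thesis
  proof (rule quadrature_weight_pos[where p = "h * h"])
    show "pint (h * h) = (\<Sum>j\<le>N. pint (lagrange N x j) * poly (h * h) (x j))"
      by (rule quadrature_exact[OF inj _ root, where m = "N + 1"])
         (auto simp: degree_legendre legendre_orthogonal_lower degree_mult_eq h0 deg)
    show "poly (h * h) (x j) = 0" if "j \<le> N" "j \<noteq> i" for j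
      using root[OF that(1)] inj_onD[OF inj, of j i] that i unfolding h by auto
    show "x i \<in> {-1..1}" using gauss_nodes[OF b i] by simp
  qed (use h0 i in auto)
qed

text \<open>By parts: the factor \<open>1 - x^2\<close> kills the boundary terms, and
  \<open>legendre N\<close> is left against a polynomial of degree below \<open>N\<close>.\<close>

lemma lobatto_orthogonal:
  assumes "degree q < N - 1"
  shows "pint ([:1, 0, -1:] * pderiv (legendre N) * q) = 0"
proof -
  have "degree ([:1, 0, -1:] * q) \<le> 2 + degree q"
    using degree_mult_le[of "[:1, 0, -1 :: real:]" q] by simp
  then have "degree (pderiv ([:1, 0, -1:] * q)) < N"
    unfolding degree_pderiv using assms by linarith
  from legendre_orthogonal_lower[OF this] show ?thesis
    using pint_by_parts[of "[:1, 0, -1:] * q" "legendre N"] by (simp add: mult_ac del: mult_pCons_left mult_pCons_right)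
qed

lemma one_minus_square_nonneg:
  assumes "t \<in> {-1..1::real}"
  shows "poly [:1, 0, -1:] t \<ge> 0"
proof -
  have "(1 - t) * (1 + t) \<ge> 0" using assms by (intro mult_nonneg_nonneg) auto
  then show ?thesis by (simp add: algebra_simps)
qed

text \<open>The derivative of \<open>legendre N\<close> is orthogonal to lower degrees for the
  weight \<open>1 - x^2\<close>, so its roots lie in the open interval; any other node is a root of
  \<open>1 - x^2\<close>.\<close>

lemma lobatto_node_cases:
  assumes b: "valid_basis N (Lobatto_Legendre x)" and i: "i \<le> N"
  shows "x i = 1 \<or> x i = -1 \<or> (-1 < x i \<and> x i < 1 \<and> poly (pderiv (legendre N)) (x i) = 0)"
proof (cases "poly (pderiv (legendre N)) (x i) = 0")
  case True
  have "pderiv (legendre N) \<noteq> 0"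
    using b by (simp add: pderiv_eq_0_iff degree_legendre)
  then have "-1 < x i \<and> x i < 1"
    using True
    by (intro root_of_orthogonal_poly[where g = "[:1, 0, -1:]" and p = "pderiv (legendre N)"])
       (auto simp: one_minus_square_nonneg lobatto_orthogonal degree_pderiv degree_legendre
          simp del: poly_pCons mult_pCons_left)
  with True show ?thesis by simp
next
  case False
  with b i have "1 - x i * x i = 0" by (auto simp: algebra_simps)
  then show ?thesis by (metis eq_iff_diff_eq_0 square_eq_1_iff)
qed

text \<open>The square used for Gauss nodes has degree \<open>2 * N\<close>, one too many here. At
  an endpoint, one linear factor vanishing at the opposite endpoint times the square of
  \<open>?P\<close> has degree \<open>2 * N - 1\<close>. At an interior node, \<open>1 - x^2\<close>
  takes care of both endpoints and only the cofactor \<open>h\<close> of \<open>?P\<close> is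
  squared.\<close>

lemma lobatto_weight_pos:
  assumes b: "valid_basis N (Lobatto_Legendre x)" and i: "i \<le> N"
  shows "pint (lagrange N x i) > 0"
proof -
  let ?P = "pderiv (legendre N)"
  let ?w = "[:1, 0, -1:] * ?P"
  have N: "N \<ge> 1" and inj: "inj_on x {..N}" and root: "\<And>i. i \<le> N \<Longrightarrow> poly ?w (x i) = 0"
    using b by (auto dest: strict_mono_on_imp_inj_on)
  have P0: "?P \<noteq> 0" using N by (simp add: pderiv_eq_0_iff degree_legendre)
  have degP: "degree ?P = N - 1" by (simp add: degree_pderiv degree_legendre)
  have degw: "degree ?w = N + 1" using N P0 by (subst degree_mult_eq) (auto simp: degP)
  note cases = lobatto_node_cases[OF b]
  have node: "x i \<in> {-1..1}" using cases[OF i] by auto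
  have *: "pint (lagrange N x i) > 0"
    if "\<And>t. t \<in> {-1..1} \<Longrightarrow> poly p t \<ge> 0" "p \<noteq> 0" "degree p < 2 * N"
      "\<And>j. j \<le> N \<Longrightarrow> x j \<noteq> x i \<Longrightarrow> poly p (x j) = 0" for p
  proof (rule quadrature_weight_pos)
    show "pint p = (\<Sum>j\<le>N. pint (lagrange N x j) * poly p (x j))"
      by (rule quadrature_exact[OF inj degw root, where m = "N - 1"])
         (use lobatto_orthogonal N that(3) in auto)
    show "poly p (x j) = 0" if "j \<le> N" "j \<noteq> i" for j
      using \<open>\<And>j. j \<le> N \<Longrightarrow> x j \<noteq> x i \<Longrightarrow> poly p (x j) = 0\<close> inj_onD[OF inj, of j i] that i by auto
  qed (use that i node in auto)
  from cases[OF i] consider "x i = 1" | "x i = -1" | "poly ?P (x i) = 0" by blast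
  then show ?thesis
  proof cases
    case 1
    show ?thesis
    proof (rule *[of "[:1, 1:] * (?P * ?P)"])
      show "degree ([:1, 1:] * (?P * ?P)) < 2 * N"
        using P0 N by (subst degree_mult_eq) (auto simp: degree_mult_eq degP)
      show "poly ([:1, 1:] * (?P * ?P)) (x j) = 0" if "j \<le> N" "x j \<noteq> x i" for j
        using cases[OF that(1)] that(2) 1 by auto
    qed (use P0 in \<open>auto simp: zero_le_mult_iff simp del: mult_pCons_left\<close>)
  next
    case 2
    show ?thesis
    proof (rule *[of "[:1, -1:] * (?P * ?P)"])
      show "degree ([:1, -1:] * (?P * ?P)) < 2 * N"
        using P0 N by (subst degree_mult_eq) (auto simp: degree_mult_eq degP)
      show "poly ([:1, -1:] * (?P * ?P)) (x j) = 0" if "j \<le> N" "x j \<noteq> x i" for j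
        using cases[OF that(1)] that(2) 2 by auto
    qed (use P0 in \<open>auto simp: zero_le_mult_iff simp del: mult_pCons_left\<close>)
  next
    case 3
    then obtain h where h: "?P = [:- x i, 1:] * h"
      by (auto simp: poly_eq_0_iff_dvd)
    then have h0: "h \<noteq> 0" using P0 by auto
    have "degree ?P = 1 + degree h"
      unfolding h using h0 by (subst degree_mult_eq) auto
    then have deg: "2 * (degree h + 1) < 2 * N" using degP N by simp
    show ?thesis
    proof (rule *[of "[:1, 0, -1:] * (h * h)"])
      show "degree ([:1, 0, -1:] * (h * h)) < 2 * N"
        using h0 deg by (subst degree_mult_eq) (auto simp: degree_mult_eq)
      show "poly ([:1, 0, -1:] * (h * h)) (x j) = 0" if "j \<le> N" "x j \<noteq> x i" for j
        using root[OF that(1)] that(2) unfolding h poly_mult mult_eq_0_iff by auto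
      show "poly ([:1, 0, -1:] * (h * h)) t \<ge> 0" if "t \<in> {-1..1}" for t
        unfolding poly_mult using one_minus_square_nonneg[OF that] by (intro mult_nonneg_nonneg zero_le_square) auto
    qed (use h0 in \<open>auto simp del: mult_pCons_left\<close>)
  qed
qed

section \<open>The discrete scalar product and the operators\<close>

text \<open>For every basis these numbers determine \<open>M\<close>: quadrature weights in the
  nodal cases, squared norms of the Legendre polynomials in the modal one.\<close>

definition mass_weight :: "nat \<Rightarrow> basis \<Rightarrow> nat \<Rightarrow> real" where
  "mass_weight N b i = mass_mat N b $$ (i, i)"

lemma mass_mat_carrier [simp]: "mass_mat N b \<in> carrier_mat (Suc N) (Suc N)"
  by (cases b) (simp_all add: quad_mass_def)

lemma deriv_mat_carrier [simp]: "deriv_mat N b \<in> carrier_mat (Suc N) (Suc N)"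
  by (simp add: deriv_mat_def)

lemma mult_mat_carrier [simp]: "mult_mat N b a \<in> carrier_mat (Suc N) (Suc N)"
  by (simp add: mult_mat_def)

lemma coeffs_of_carrier [simp]: "coeffs_of N b g \<in> carrier_vec (Suc N)"
  by (cases b) simp_all

lemmas operator_dims [simp] =
  mass_mat_carrier[THEN carrier_matD(1)] mass_mat_carrier[THEN carrier_matD(2)]
  deriv_mat_carrier[THEN carrier_matD(1)] deriv_mat_carrier[THEN carrier_matD(2)]
  mult_mat_carrier[THEN carrier_matD(1)] mult_mat_carrier[THEN carrier_matD(2)]
  coeffs_of_carrier[THEN carrier_vecD]

lemma integral_poly_mult: "integral {-1..1} (\<lambda>t. poly p t * poly q t) = pint (p * q)"
  by (simp add: pint_def poly_mult[abs_def])

lemma mass_weight_nodal: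
  assumes "b \<in> {Gauss_Legendre x, Lobatto_Legendre x}" "i \<le> N"
  shows "mass_weight N b i = pint (lagrange N x i)"
  using assms by (auto simp: mass_weight_def quad_mass_def pint_def)

lemma mass_weight_modal:
  assumes "i \<le> N"
  shows "mass_weight N Modal_Legendre i = pint (legendre i * legendre i)"
  using assms by (simp add: mass_weight_def integral_poly_mult)

lemma mass_weight_pos:
  assumes "valid_basis N b" "i \<le> N"
  shows "mass_weight N b i > 0"
proof (cases b)
  case (Gauss_Legendre x)
  then show ?thesis using gauss_weight_pos assms mass_weight_nodal[of b x i N] by auto
next
  case (Lobatto_Legendre x)
  then show ?thesis using lobatto_weight_pos assms mass_weight_nodal[of b x i N] by auto
next
  case Modal_Legendre
  then show ?thesis using assms by (simp add: mass_weight_modal legendre_norm_pos)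
qed

text \<open>In the modal case this is the orthogonality of the Legendre polynomials. It allows all
  three bases to be treated as weighted sums from here on.\<close>

lemma mass_mat_diag:
  "mass_mat N b = mat (N + 1) (N + 1) (\<lambda>(i, j). if i = j then mass_weight N b i else 0)"
  by (cases b)
     (auto simp: mass_weight_def quad_mass_def integral_poly_mult legendre_orthogonal intro!: eq_matI)

lemma mass_mat_mult_vec:
  assumes "v \<in> carrier_vec (N + 1)" "i \<le> N"
  shows "(mass_mat N b *\<^sub>v v) $ i = mass_weight N b i * v $ i"
proof -
  have "(mass_mat N b *\<^sub>v v) $ i = (\<Sum>j\<le>N. (if i = j then mass_weight N b i else 0) * v $ j)"
    using assms
    by (subst mass_mat_diag)
       (simp add: scalar_prod_def atLeast0LessThan lessThan_Suc_atMost del: sum.lessThan_Suc sum.atMost_Suc)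
  also have "\<dots> = (\<Sum>j\<le>N. if i = j then mass_weight N b i * v $ j else 0)"
    by (intro sum.cong) auto
  finally show ?thesis using assms by simp
qed

lemma ip_M_sum:
  assumes "u \<in> carrier_vec (N + 1)" "v \<in> carrier_vec (N + 1)"
  shows "ip_M N b u v = (\<Sum>i\<le>N. mass_weight N b i * u $ i * v $ i)"
  unfolding ip_M_def scalar_prod_def
proof (rule sum.cong)
  show "{0..<dim_vec (mass_mat N b *\<^sub>v v)} = {..N}" by auto
  fix i assume "i \<in> {..N}"
  then show "u $ i * (mass_mat N b *\<^sub>v v) $ i = mass_weight N b i * u $ i * v $ i"
    using mass_mat_mult_vec[OF assms(2), of i b] by simp
qed

lemma ip_M_commute:
  assumes "u \<in> carrier_vec (N + 1)" "v \<in> carrier_vec (N + 1)"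
  shows "ip_M N b u v = ip_M N b v u"
  using assms by (simp add: ip_M_sum mult_ac)

lemma ip_M_add_right:
  assumes "u \<in> carrier_vec (N + 1)" "v \<in> carrier_vec (N + 1)" "w \<in> carrier_vec (N + 1)"
  shows "ip_M N b u (v + w) = ip_M N b u v + ip_M N b u w"
  using assms by (simp add: ip_M_sum algebra_simps sum.distrib)

lemma ip_M_add_left:
  assumes "u \<in> carrier_vec (N + 1)" "v \<in> carrier_vec (N + 1)" "w \<in> carrier_vec (N + 1)"
  shows "ip_M N b (v + w) u = ip_M N b v u + ip_M N b w u"
  using assms by (simp add: ip_M_sum algebra_simps sum.distrib)

lemma ip_M_smult_right:
  assumes "u \<in> carrier_vec (N + 1)" "v \<in> carrier_vec (N + 1)"
  shows "ip_M N b u (c \<cdot>\<^sub>v v) = c * ip_M N b u v"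
  using assms by (simp add: ip_M_sum sum_distrib_left mult_ac)

lemma ip_M_smult_left:
  assumes "u \<in> carrier_vec (N + 1)" "v \<in> carrier_vec (N + 1)"
  shows "ip_M N b (c \<cdot>\<^sub>v v) u = c * ip_M N b v u"
  using assms by (simp add: ip_M_sum sum_distrib_left mult_ac)

lemma ip_M_zero_left:
  assumes "u \<in> carrier_vec (N + 1)"
  shows "ip_M N b (0\<^sub>v (N + 1)) u = 0"
  using assms by (simp add: ip_M_sum)

lemma ip_M_zero_right:
  assumes "u \<in> carrier_vec (N + 1)"
  shows "ip_M N b u (0\<^sub>v (N + 1)) = 0"
  using assms by (simp add: ip_M_sum)

lemma norm2_M_nonneg:
  assumes "valid_basis N b" "u \<in> carrier_vec (N + 1)"
  shows "norm2_M N b u \<ge> 0"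
  using assms mass_weight_pos[OF assms(1)]
  by (auto simp: norm2_M_def ip_M_sum mult.assoc less_imp_le intro!: sum_nonneg mult_nonneg_nonneg[OF _ zero_le_square])

lemma norm2_M_eq_0:
  assumes b: "valid_basis N b" and u: "u \<in> carrier_vec (N + 1)" and "norm2_M N b u = 0"
  shows "u = 0\<^sub>v (N + 1)"
proof -
  have "\<forall>i\<in>{..N}. mass_weight N b i * (u $ i * u $ i) = 0"
  proof (subst sum_nonneg_eq_0_iff[symmetric])
    show "(\<Sum>i\<le>N. mass_weight N b i * (u $ i * u $ i)) = 0"
      using assms by (simp add: norm2_M_def ip_M_sum mult.assoc)
  qed (use mass_weight_pos[OF b] in \<open>auto simp: less_imp_le\<close>)
  then have "u $ i = 0" if "i \<le> N" for i
  proof -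
    from \<open>\<forall>i\<in>{..N}. _\<close> that have "mass_weight N b i * (u $ i * u $ i) = 0" by blast
    with mass_weight_pos[OF b that] show ?thesis by simp
  qed
  then show ?thesis using u by (intro eq_vecI) auto
qed

section \<open>Coefficient vectors and the polynomials they represent\<close>

lemma coeffs_of_modal:
  assumes "i \<le> N"
  shows "coeffs_of N Modal_Legendre (poly p) $ i
    = pint (p * legendre i) / mass_weight N Modal_Legendre i"
  using assms by (simp add: mass_weight_modal integral_poly_mult power2_eq_square)

text \<open>Linearity in the form needed for expansions in the basis; the empty sum yields the zero
  polynomial.\<close>

lemma coeffs_of_linear:
  assumes "i \<le> N"
  shows "coeffs_of N b (poly (\<Sum>k\<in>I. Polynomial.smult (c k) (p k))) $ i
    = (\<Sum>k\<in>I. c k * coeffs_of N b (poly (p k)) $ i)"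
proof (cases b)
  case Modal_Legendre
  then show ?thesis
    using assms by (simp add: coeffs_of_modal sum_distrib_right sum_divide_distrib pint_sum pint_smult
        del: coeffs_of.simps)
qed (use assms in \<open>simp_all add: poly_sum\<close>)

lemma coeffs_of_zero: "coeffs_of N b (poly 0) = 0\<^sub>v (N + 1)"
  using coeffs_of_linear[of _ N b _ _ "{}"] by (intro eq_vecI) (auto simp del: coeffs_of.simps)

lemma to_poly_add:
  assumes "u \<in> carrier_vec (N + 1)" "v \<in> carrier_vec (N + 1)"
  shows "to_poly N b (u + v) = to_poly N b u + to_poly N b v"
  using assms by (simp add: to_poly_def smult_add_left sum.distrib)

lemma smult_sum_right: "Polynomial.smult c (sum f I) = (\<Sum>i\<in>I. Polynomial.smult c (f i))"
  using sum_distrib_left[of "[:c:]" f I] by simp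

lemma to_poly_smult:
  assumes "u \<in> carrier_vec (N + 1)"
  shows "to_poly N b (c \<cdot>\<^sub>v u) = Polynomial.smult c (to_poly N b u)"
  using assms by (simp add: to_poly_def smult_sum_right)

lemma degree_to_poly: "degree (to_poly N b u) \<le> N"
proof -
  have "degree (basis_poly N b k) \<le> N" if "k \<le> N" for k
    using that by (cases b) (simp_all add: degree_lagrange degree_legendre)
  then show ?thesis unfolding to_poly_def
    by (intro degree_sum_le) (auto intro: order_trans[OF degree_smult_le])
qed

lemma inj_on_nodes:
  assumes "valid_basis N b" "b \<in> {Gauss_Legendre x, Lobatto_Legendre x}"
  shows "inj_on x {..N}"
  using assms by (auto dest: strict_mono_on_imp_inj_on)

lemma coeffs_of_nodal:
  assumes "b \<in> {Gauss_Legendre x, Lobatto_Legendre x}" "i \<le> N"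
  shows "coeffs_of N b g $ i = g (x i)"
  using assms by auto

text \<open>Lagrange interpolation in the nodal cases; in the modal case orthogonality lets the
  projection recover the Legendre coefficients.\<close>

lemma to_poly_coeffs_of:
  assumes b: "valid_basis N b" and p: "degree p \<le> N"
  shows "to_poly N b (coeffs_of N b (poly p)) = p"
proof -
  have nodal: ?thesis if x: "b \<in> {Gauss_Legendre x, Lobatto_Legendre x}" for x
  proof -
    have "basis_poly N b k = lagrange N x k" for k using x by auto
    then show ?thesis
      using lagrange_interpolation[OF inj_on_nodes[OF b x] p]
      by (simp add: to_poly_def coeffs_of_nodal[OF x])
  qed
  show ?thesis
  proof (cases b)
    case Modal_Legendre
    obtain c where c: "p = (\<Sum>k\<le>N. Polynomial.smult (c k) (legendre k))"
      using legendre_expansion[OF p] by blast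
    have "coeffs_of N b (poly p) $ i = c i" if "i \<le> N" for i
    proof -
      have "pint (p * legendre i) = (\<Sum>k\<le>N. c k * pint (legendre k * legendre i))"
        by (simp add: c sum_distrib_right pint_sum pint_smult)
      also have "\<dots> = (\<Sum>k\<in>{i}. c k * pint (legendre k * legendre i))"
        by (rule sum.mono_neutral_right) (use that legendre_orthogonal in auto)
      finally show ?thesis
        using that mass_weight_pos[OF b that] Modal_Legendre
        by (simp add: coeffs_of_modal mass_weight_modal del: coeffs_of.simps)
    qed
    then show ?thesis
      by (simp add: to_poly_def Modal_Legendre c del: coeffs_of.simps)
  qed (use nodal in auto)
qed

lemma deriv_mat_mult_vec:
  assumes "u \<in> carrier_vec (N + 1)"
  shows "deriv_mat N b *\<^sub>v u = coeffs_of N b (poly (pderiv (to_poly N b u)))"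
proof (rule eq_vecI)
  fix i assume "i < dim_vec (coeffs_of N b (poly (pderiv (to_poly N b u))))"
  then have i: "i \<le> N" by (simp add: less_Suc_eq_le)
  then show "(deriv_mat N b *\<^sub>v u) $ i = coeffs_of N b (poly (pderiv (to_poly N b u))) $ i"
    using assms
    by (simp add: deriv_mat_def to_poly_def higher_pderiv_sum[of 1, simplified] pderiv_smult
        coeffs_of_linear scalar_prod_def atLeast0LessThan lessThan_Suc_atMost mult.commute
        del: coeffs_of.simps)
qed simp

lemma mult_mat_mult_vec:
  assumes "u \<in> carrier_vec (N + 1)"
  shows "mult_mat N b a *\<^sub>v u = coeffs_of N b (poly (a * to_poly N b u))"
proof (rule eq_vecI)
  fix i assume "i < dim_vec (coeffs_of N b (poly (a * to_poly N b u)))"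
  then have i: "i \<le> N" by (simp add: less_Suc_eq_le)
  then show "(mult_mat N b a *\<^sub>v u) $ i = coeffs_of N b (poly (a * to_poly N b u)) $ i"
    using assms
    by (simp add: mult_mat_def to_poly_def sum_distrib_left
        coeffs_of_linear scalar_prod_def atLeast0LessThan lessThan_Suc_atMost mult.commute
        del: coeffs_of.simps)
qed simp

lemma to_poly_deriv_mat:
  assumes "valid_basis N b" "u \<in> carrier_vec (N + 1)"
  shows "to_poly N b (deriv_mat N b *\<^sub>v u) = pderiv (to_poly N b u)"
  using degree_to_poly[of N b u]
  by (simp add: deriv_mat_mult_vec[OF assms(2)] to_poly_coeffs_of[OF assms(1)] degree_pderiv)

lemma deriv_mat_one:
  assumes "valid_basis N b"
  shows "deriv_mat N b *\<^sub>v coeffs_of N b (poly 1) = 0\<^sub>v (N + 1)"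
  by (simp add: deriv_mat_mult_vec to_poly_coeffs_of[OF assms] coeffs_of_zero)

text \<open>The normalisation in the projection cancels against the mass weight. The degree of
  \<open>p\<close> is arbitrary: what the projection discards is orthogonal to the polynomial of
  \<open>u\<close>.\<close>

lemma ip_M_coeffs_modal:
  assumes "u \<in> carrier_vec (N + 1)"
  shows "ip_M N Modal_Legendre u (coeffs_of N Modal_Legendre (poly p))
    = pint (p * to_poly N Modal_Legendre u)"
proof -
  have "ip_M N Modal_Legendre u (coeffs_of N Modal_Legendre (poly p))
    = (\<Sum>i\<le>N. u $ i * pint (p * legendre i))"
    using assms
    by (auto simp: ip_M_sum coeffs_of_modal less_imp_neq[OF mass_weight_pos, symmetric]
        simp del: coeffs_of.simps intro!: sum.cong)
  then show ?thesis
    by (simp add: to_poly_def sum_distrib_left pint_sum pint_smult)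
qed

lemma ip_M_coeffs_nodal:
  assumes "b \<in> {Gauss_Legendre x, Lobatto_Legendre x}" "u \<in> carrier_vec (N + 1)"
  shows "ip_M N b u (coeffs_of N b g) = (\<Sum>i\<le>N. mass_weight N b i * u $ i * g (x i))"
  using assms(2) by (simp add: ip_M_sum coeffs_of_nodal[OF assms(1)])

text \<open>Conservation becomes a statement about the scalar product with the constant 1.
  Quadrature is exact here even for Lobatto nodes, as the weights are the integrals of the Lagrange
  polynomials.\<close>

lemma pint_to_poly:
  assumes "u \<in> carrier_vec (N + 1)"
  shows "pint (to_poly N b u) = ip_M N b (coeffs_of N b (poly 1)) u"
proof -
  have nodal: ?thesis if x: "b \<in> {Gauss_Legendre x, Lobatto_Legendre x}" for x
  proof -
    have "basis_poly N b k = lagrange N x k" for k using x by auto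
    then show ?thesis
      using assms ip_M_commute[OF assms, of "coeffs_of N b (poly 1)" b]
      by (simp add: ip_M_coeffs_nodal[OF x] to_poly_def pint_sum pint_smult
          mass_weight_nodal[OF x] mult.commute)
  qed
  show ?thesis
  proof (cases b)
    case Modal_Legendre
    then show ?thesis
      using assms ip_M_commute[OF assms, of "coeffs_of N b (poly 1)" b]
      by (simp add: ip_M_coeffs_modal del: coeffs_of.simps)
  qed (use nodal in auto)
qed

section \<open>The dissipation form\<close>

lemma mat_diag_mult:
  fixes f g :: "nat \<Rightarrow> real"
  shows "mat n n (\<lambda>(i, j). if i = j then f i else 0) * mat n n (\<lambda>(i, j). if i = j then g i else 0)
    = mat n n (\<lambda>(i, j). if i = j then f i * g i else 0)" (is "?F * ?G = ?H")
proof (rule eq_matI)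
  fix i j assume "i < dim_row ?H" "j < dim_col ?H"
  then have ij: "i < n" "j < n" by simp_all
  then have "(?F * ?G) $$ (i, j) = (\<Sum>k<n. (if i = k then f i else 0) * (if k = j then g k else 0))"
    by (simp add: scalar_prod_def atLeast0LessThan)
  also have "\<dots> = (\<Sum>k<n. if i = k then f i * (if k = j then g k else 0) else 0)"
    by (intro sum.cong) auto
  finally show "(?F * ?G) $$ (i, j) = ?H $$ (i, j)" using ij by simp
qed simp_all

text \<open>\<open>mat_inverse\<close> returns an option; an explicit two-sided diagonal inverse
  makes \<open>M\<close> a unit of the matrix ring and so excludes \<open>None\<close>.\<close>

lemma mass_mat_inverse:
  assumes b: "valid_basis N b"
  shows "mass_mat N b * the (mat_inverse (mass_mat N b)) = 1\<^sub>m (N + 1)"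
    and "the (mat_inverse (mass_mat N b)) \<in> carrier_mat (N + 1) (N + 1)"
proof -
  let ?W = "mat (N + 1) (N + 1) (\<lambda>(i, j). if i = j then 1 / mass_weight N b i else 0)"
  have one: "mat (N + 1) (N + 1) (\<lambda>(i, j). if i = j then f i else 0) = 1\<^sub>m (N + 1)"
    if "\<And>i. i \<le> N \<Longrightarrow> f i = (1 :: real)" for f
    using that by (intro eq_matI) auto
  have nz: "mass_weight N b i \<noteq> 0" if "i \<le> N" for i
    using mass_weight_pos[OF b that] by simp
  have "mass_mat N b * ?W = 1\<^sub>m (N + 1)"
    unfolding mass_mat_diag mat_diag_mult by (rule one) (use nz in simp)
  moreover have "?W * mass_mat N b = 1\<^sub>m (N + 1)"
    unfolding mass_mat_diag mat_diag_mult by (rule one) (use nz in simp)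
  ultimately have "mass_mat N b \<in> Units (ring_mat TYPE(real) (N + 1) ())"
    by (auto simp: Units_def ring_mat_def intro!: bexI[of _ ?W])
  then obtain B where "mat_inverse (mass_mat N b) = Some B"
    using mat_inverse(1)[of "mass_mat N b" "N + 1" "()"] by (cases "mat_inverse (mass_mat N b)") auto
  with mat_inverse(2)[of "mass_mat N b" "N + 1" B]
  show "mass_mat N b * the (mat_inverse (mass_mat N b)) = 1\<^sub>m (N + 1)"
    and "the (mat_inverse (mass_mat N b)) \<in> carrier_mat (N + 1) (N + 1)"
    by simp_all
qed

lemma diss_mat_carrier:
  assumes "valid_basis N b"
  shows "diss_mat N b a \<in> carrier_mat (N + 1) (N + 1)"
  using mass_mat_inverse(2)[OF assms]
  unfolding diss_mat_def by (intro mult_carrier_mat[of _ _ "N + 1"]) simp_all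

text \<open>The \<open>M\<close> of the scalar product cancels the inverse in \<open>A\<close>, and
  \<open>D^T\<close> is the adjoint of \<open>D\<close> for the dot product.\<close>

lemma ip_M_diss_mat:
  assumes b: "valid_basis N b" and u: "u \<in> carrier_vec (N + 1)" and v: "v \<in> carrier_vec (N + 1)"
  shows "ip_M N b u (diss_mat N b a *\<^sub>v v)
    = ip_M N b (deriv_mat N b *\<^sub>v u) (mult_mat N b a *\<^sub>v (deriv_mat N b *\<^sub>v v))"
proof -
  let ?M = "mass_mat N b" and ?D = "deriv_mat N b" and ?T = "mult_mat N b a" and ?n = "Suc N"
  let ?I = "the (mat_inverse ?M)"
  have I: "?I \<in> carrier_mat ?n ?n" "?M * ?I = 1\<^sub>m ?n"
    using mass_mat_inverse[OF b] by simp_all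
  have v': "v \<in> carrier_vec ?n" and u': "u \<in> carrier_vec ?n" using u v by simp_all
  let ?z = "?M *\<^sub>v (?T *\<^sub>v (?D *\<^sub>v v))"
  have z: "?z \<in> carrier_vec ?n" using v' by (intro mult_mat_vec_carrier) auto
  have c: "?I * transpose_mat ?D \<in> carrier_mat ?n ?n" using I by (intro mult_carrier_mat) auto
  have "diss_mat N b a *\<^sub>v v = ?I *\<^sub>v (transpose_mat ?D *\<^sub>v ?z)"
  proof -
    have "diss_mat N b a *\<^sub>v v = (?I * transpose_mat ?D * ?M * ?T) *\<^sub>v (?D *\<^sub>v v)"
      unfolding diss_mat_def using I v' by (intro assoc_mult_mat_vec[of _ ?n ?n _ ?n]) auto
    also have "\<dots> = (?I * transpose_mat ?D * ?M) *\<^sub>v (?T *\<^sub>v (?D *\<^sub>v v))"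
      using I v' by (intro assoc_mult_mat_vec[of _ ?n ?n _ ?n] mult_mat_vec_carrier) auto
    also have "\<dots> = (?I * transpose_mat ?D) *\<^sub>v ?z"
      using I v' by (intro assoc_mult_mat_vec[of _ ?n ?n _ ?n] mult_mat_vec_carrier) auto
    also have "\<dots> = ?I *\<^sub>v (transpose_mat ?D *\<^sub>v ?z)"
      using I v' z by (intro assoc_mult_mat_vec[of _ ?n ?n _ ?n]) auto
    finally show ?thesis .
  qed
  moreover have "?M *\<^sub>v (?I *\<^sub>v (transpose_mat ?D *\<^sub>v ?z)) = transpose_mat ?D *\<^sub>v ?z"
  proof -
    have t: "transpose_mat ?D *\<^sub>v ?z \<in> carrier_vec ?n"
      using v' z by (intro mult_mat_vec_carrier) auto
    have "?M *\<^sub>v (?I *\<^sub>v (transpose_mat ?D *\<^sub>v ?z)) = (?M * ?I) *\<^sub>v (transpose_mat ?D *\<^sub>v ?z)"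
      using I v' t by (intro assoc_mult_mat_vec[of _ ?n ?n _ ?n, symmetric]) auto
    then show ?thesis using I t by simp
  qed
  ultimately have "ip_M N b u (diss_mat N b a *\<^sub>v v) = u \<bullet> (transpose_mat ?D *\<^sub>v ?z)"
    by (simp add: ip_M_def)
  also have "\<dots> = (transpose_mat ?D *\<^sub>v ?z) \<bullet> u"
    using u' v' z by (intro comm_scalar_prod[of _ ?n] mult_mat_vec_carrier[of _ ?n ?n]) simp_all
  also have "\<dots> = ?z \<bullet> (?D *\<^sub>v u)"
    using u' v' z by (intro transpose_vec_mult_scalar[of _ ?n ?n]) simp_all
  also have "\<dots> = (?D *\<^sub>v u) \<bullet> ?z"
    using u' v' z by (intro comm_scalar_prod[of _ ?n] mult_mat_vec_carrier[of _ ?n ?n]) simp_all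
  finally show ?thesis by (simp add: ip_M_def)
qed

text \<open>Pair with the constant 1, whose discrete derivative is zero.\<close>

lemma diss_mat_integral_zero:
  assumes "valid_basis N b" "v \<in> carrier_vec (N + 1)"
  shows "pint (to_poly N b (diss_mat N b a *\<^sub>v v)) = 0"
proof -
  have "deriv_mat N b *\<^sub>v v \<in> carrier_vec (N + 1)" "diss_mat N b a *\<^sub>v v \<in> carrier_vec (N + 1)"
    using assms diss_mat_carrier[OF assms(1), of a] by (auto intro!: mult_mat_vec_carrier)
  then show ?thesis
    using assms ip_M_zero_left[of "mult_mat N b a *\<^sub>v (deriv_mat N b *\<^sub>v v)" N b]
    by (simp add: pint_to_poly ip_M_diss_mat deriv_mat_one mult_mat_mult_vec)
qed

text \<open>Differentiation is exact, and the projection after multiplying by \<open>a\<close> is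
  invisible to the derivative of \<open>u\<close>, which has degree at most
  \<open>N\<close>.\<close>

lemma diss_form_modal:
  assumes "u \<in> carrier_vec (N + 1)" "v \<in> carrier_vec (N + 1)"
  defines "b \<equiv> Modal_Legendre"
  shows "ip_M N b u (diss_mat N b a *\<^sub>v v)
    = pint (a * (pderiv (to_poly N b u) * pderiv (to_poly N b v)))"
proof -
  have b: "valid_basis N b" by (simp add: b_def)
  have "deriv_mat N b *\<^sub>v u \<in> carrier_vec (N + 1)" "deriv_mat N b *\<^sub>v v \<in> carrier_vec (N + 1)"
    using assms by (auto intro!: mult_mat_vec_carrier)
  then show ?thesis
    using assms(1,2) ip_M_coeffs_modal[of "deriv_mat N b *\<^sub>v u" N]
    by (simp add: ip_M_diss_mat[OF b] mult_mat_mult_vec to_poly_deriv_mat[OF b] mult_ac flip: b_def)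
qed

lemma diss_form_nodal:
  assumes b: "valid_basis N b" and x: "b \<in> {Gauss_Legendre x, Lobatto_Legendre x}"
    and "u \<in> carrier_vec (N + 1)" "v \<in> carrier_vec (N + 1)"
  shows "ip_M N b u (diss_mat N b a *\<^sub>v v)
    = (\<Sum>i\<le>N. mass_weight N b i * (poly a (x i) *
         (poly (pderiv (to_poly N b u)) (x i) * poly (pderiv (to_poly N b v)) (x i))))"
proof -
  have "deriv_mat N b *\<^sub>v u \<in> carrier_vec (N + 1)" "deriv_mat N b *\<^sub>v v \<in> carrier_vec (N + 1)"
    using assms by (auto intro!: mult_mat_vec_carrier)
  moreover have "(deriv_mat N b *\<^sub>v u) $ i = poly (pderiv (to_poly N b u)) (x i)" if "i \<le> N" for i
    using assms(3) that by (simp only: deriv_mat_mult_vec coeffs_of_nodal[OF x])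
  ultimately show ?thesis
    using assms(3,4)
    by (simp add: ip_M_diss_mat[OF b] mult_mat_mult_vec to_poly_deriv_mat[OF b]
        ip_M_coeffs_nodal[OF x] mult_ac del: index_mult_mat_vec)
qed

lemma diss_form_symmetric:
  assumes b: "valid_basis N b" and "u \<in> carrier_vec (N + 1)" "v \<in> carrier_vec (N + 1)"
  shows "ip_M N b u (diss_mat N b a *\<^sub>v v) = ip_M N b v (diss_mat N b a *\<^sub>v u)"
  using assms diss_form_nodal[OF b] diss_form_modal by (cases b) (auto simp: mult_ac)

lemma node_in_interval:
  assumes "valid_basis N b" "b \<in> {Gauss_Legendre x, Lobatto_Legendre x}" "i \<le> N"
  shows "x i \<in> {-1..1}"
  using assms gauss_nodes[of N x i] lobatto_node_cases[of N x i] by auto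

lemma diss_form_nonneg:
  assumes b: "valid_basis N b" and a: "\<forall>t\<in>{-1..1}. poly a t \<ge> 0" and u: "u \<in> carrier_vec (N + 1)"
  shows "ip_M N b u (diss_mat N b a *\<^sub>v u) \<ge> 0"
proof -
  have nodal: ?thesis if x: "b \<in> {Gauss_Legendre x, Lobatto_Legendre x}" for x
    unfolding diss_form_nodal[OF b x u u]
    using mass_weight_pos[OF b] node_in_interval[OF b x] a
    by (intro sum_nonneg mult_nonneg_nonneg zero_le_square) (auto simp: less_imp_le)
  show ?thesis
  proof (cases b)
    case Modal_Legendre
    show ?thesis
      unfolding Modal_Legendre diss_form_modal[OF u u]
      by (rule pint_nonneg) (use a in \<open>simp add: poly_mult\<close>)
  qed (use nodal in auto)
qed

text \<open>With positive weights and nodes in the interval, a sum of nonnegative terms vanishes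
  only termwise.\<close>

lemma diss_form_zero_nodal:
  assumes b: "valid_basis N b" and x: "b \<in> {Gauss_Legendre x, Lobatto_Legendre x}"
    and a: "\<forall>t\<in>{-1..1}. poly a t \<ge> 0" and u: "u \<in> carrier_vec (N + 1)"
  shows "ip_M N b u (diss_mat N b a *\<^sub>v u) = 0 \<longleftrightarrow>
    (\<forall>i\<le>N. poly a (x i) * poly (pderiv (to_poly N b u)) (x i) = 0)"
proof -
  have "ip_M N b u (diss_mat N b a *\<^sub>v u) = 0 \<longleftrightarrow>
    (\<forall>i\<in>{..N}. mass_weight N b i * (poly a (x i) *
         (poly (pderiv (to_poly N b u)) (x i) * poly (pderiv (to_poly N b u)) (x i))) = 0)"
    unfolding diss_form_nodal[OF b x u u]
    using mass_weight_pos[OF b] node_in_interval[OF b x] a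
    by (intro sum_nonneg_eq_0_iff mult_nonneg_nonneg zero_le_square) (auto simp: less_imp_le)
  also have "\<dots> \<longleftrightarrow> (\<forall>i\<le>N. poly a (x i) * poly (pderiv (to_poly N b u)) (x i) = 0)"
    using less_imp_neq[OF mass_weight_pos[OF b]] by fastforce
  finally show ?thesis .
qed

section \<open>The kernel of the dissipation form and its powers\<close>

lemma constant_iff_pderiv_zero:
  fixes p :: "real poly"
  shows "(\<exists>c. p = [:c:]) \<longleftrightarrow> pderiv p = 0"
  by (metis degree_eq_zeroE degree_pCons_0 pderiv_eq_0_iff)

text \<open>At Lobatto nodes only the \<open>N - 1\<close> interior values of \<open>p'\<close> are seen, and they are the roots
  of \<open>pderiv (legendre N)\<close>, so \<open>p'\<close> is determined up to a multiple of that polynomial.\<close>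

lemma lobatto_kernel:
  assumes b: "valid_basis N (Lobatto_Legendre x)" and p: "degree p \<le> N"
  shows "(\<forall>i\<le>N. poly [:1, 0, -1:] (x i) * poly (pderiv p) (x i) = 0) \<longleftrightarrow>
    (\<exists>c d. p = [:c:] + Polynomial.smult d (legendre N))"
proof
  let ?P = "pderiv (legendre N)"
  have N: "N \<ge> 1" and inj: "inj_on x {..N}" and root: "\<And>i. i \<le> N \<Longrightarrow> poly ([:1, 0, -1:] * ?P) (x i) = 0"
    using b by (auto dest: strict_mono_on_imp_inj_on)
  {
    assume zero: "\<forall>i\<le>N. poly [:1, 0, -1:] (x i) * poly (pderiv p) (x i) = 0"
    have degP: "degree ?P = N - 1" by (simp add: degree_pderiv degree_legendre)
    have P0: "?P \<noteq> 0" using N by (simp add: pderiv_eq_0_iff degree_legendre)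
    then have lc: "poly.coeff ?P (N - 1) \<noteq> 0" using degP by (metis leading_coeff_0_iff)
    \<comment> \<open>\<open>d\<close> cancels the coefficient of degree \<open>N - 1\<close> in
      \<open>pderiv p\<close>.\<close>
    define d where "d = poly.coeff (pderiv p) (N - 1) / poly.coeff ?P (N - 1)"
    define q where "q = pderiv (p - Polynomial.smult d (legendre N))"
    have q_eq: "q = pderiv p - Polynomial.smult d ?P"
      by (simp add: q_def pderiv_diff pderiv_smult)
    have "degree q \<le> N - 1"
      using p degree_diff_le[of p N "Polynomial.smult d (legendre N)"]
      by (simp add: q_def degree_pderiv degree_legendre diff_le_mono)
    moreover have "poly.coeff q (N - 1) = 0" using lc by (simp add: q_eq d_def)
    \<comment> \<open>This drop in degree is what makes \<open>(1 - x^2) q\<close> have degree at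
      most \<open>N\<close>, so that its \<open>N + 1\<close> zeros at the nodes force it to
      vanish.\<close>
    ultimately have "q = 0 \<or> degree q + 2 \<le> N"
      by (metis Suc_leI add_2_eq_Suc' le_neq_implies_less leading_coeff_0_iff less_diff_conv plus_1_eq_Suc
          add.commute)
    moreover have "poly ([:1, 0, -1:] * q) (x i) = 0" if "i \<le> N" for i
    proof -
      have "poly ([:1, 0, -1:] * q) (x i) = poly [:1, 0, -1:] (x i) * poly (pderiv p) (x i)
          - d * poly ([:1, 0, -1:] * ?P) (x i)"
        unfolding q_eq poly_mult poly_diff poly_smult by (simp only: right_diff_distrib mult_ac)
      then show ?thesis using zero root that by (simp only: mult_zero_right diff_self)
    qed
    moreover have "degree ([:1, 0, -1:] * q) \<le> 2 + degree q"
      using degree_mult_le[of "[:1, 0, -1 :: real:]" q] by simp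
    ultimately have "q = 0"
      using poly_zero_at_nodes[OF inj, of "[:1, 0, -1:] * q"]
      by (cases "q = 0") (auto simp del: mult_pCons_left)
    then obtain c where "p - Polynomial.smult d (legendre N) = [:c:]"
      unfolding q_def by (metis constant_iff_pderiv_zero)
    then have "p = [:c:] + Polynomial.smult d (legendre N)" by (simp only: diff_eq_eq)
    then show "\<exists>c d. p = [:c:] + Polynomial.smult d (legendre N)" by blast
  }
  assume "\<exists>c d. p = [:c:] + Polynomial.smult d (legendre N)"
  then obtain c d where "p = [:c:] + Polynomial.smult d (legendre N)" by blast
  then have "pderiv p = Polynomial.smult d ?P"
    by (simp add: pderiv_add pderiv_smult pderiv_pCons)
  then show "\<forall>i\<le>N. poly [:1, 0, -1:] (x i) * poly (pderiv p) (x i) = 0"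
    using root by (auto simp only: poly_smult poly_mult mult_eq_0_iff)
qed

text \<open>Gauss nodes are interior, so \<open>p'\<close> vanishes at \<open>N + 1\<close> points;
  in the modal case \<open>(1 - x^2) p'^2\<close> is a nonnegative polynomial with zero integral. In
  both cases \<open>p' = 0\<close>. For Lobatto nodes the answer is
  \<open>lobatto_kernel\<close>.\<close>

lemma diss_form_zero_iff:
  assumes b: "valid_basis N b" and u: "u \<in> carrier_vec (N + 1)"
  shows "ip_M N b u (diss_mat N b [:1, 0, -1:] *\<^sub>v u) = 0 \<longleftrightarrow>
    (\<exists>c. to_poly N b u = [:c:]) \<or>
    is_Lobatto b \<and> (\<exists>c d. to_poly N b u = [:c:] + Polynomial.smult d (legendre N))"
proof -
  let ?a = "[:1, 0, -1 :: real:]" and ?u = "to_poly N b u"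
  have a: "\<forall>t\<in>{-1..1}. poly ?a t \<ge> 0" using one_minus_square_nonneg by blast
  show ?thesis
  proof (cases b)
    case (Gauss_Legendre x)
    then have x: "b \<in> {Gauss_Legendre x, Lobatto_Legendre x}" by simp
    have "poly ?a (x i) \<noteq> 0" if "i \<le> N" for i
    proof -
      have "(1 - x i) * (1 + x i) > 0"
        using gauss_nodes[OF b[unfolded Gauss_Legendre] that] by (intro mult_pos_pos) auto
      then show ?thesis by (simp add: algebra_simps)
    qed
    then have "ip_M N b u (diss_mat N b ?a *\<^sub>v u) = 0 \<longleftrightarrow> (\<forall>i\<le>N. poly (pderiv ?u) (x i) = 0)"
      unfolding diss_form_zero_nodal[OF b x a u] mult_eq_0_iff by blast
    also have "\<dots> \<longleftrightarrow> pderiv ?u = 0"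
      using poly_zero_at_nodes[OF inj_on_nodes[OF b x], of "pderiv ?u"] degree_to_poly[of N b u]
      by (auto simp: degree_pderiv)
    finally show ?thesis using Gauss_Legendre by (simp add: constant_iff_pderiv_zero)
  next
    case (Lobatto_Legendre x)
    then have x: "b \<in> {Gauss_Legendre x, Lobatto_Legendre x}" by simp
    have "\<exists>c d. p = [:c:] + Polynomial.smult d (legendre N)" if "p = [:c:]" for p c
      using that by (intro exI[of _ c] exI[of _ 0]) simp
    then show ?thesis
      using diss_form_zero_nodal[OF b x a u]
        lobatto_kernel[OF b[unfolded Lobatto_Legendre] degree_to_poly[of N b u]] Lobatto_Legendre
      by auto
  next
    case Modal_Legendre
    have "pint (?a * (pderiv ?u * pderiv ?u)) = 0 \<longleftrightarrow> pderiv ?u = 0"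
    proof
      assume 0: "pint (?a * (pderiv ?u * pderiv ?u)) = 0"
      show "pderiv ?u = 0"
      proof (rule ccontr)
        assume "pderiv ?u \<noteq> 0"
        then have "?a * (pderiv ?u * pderiv ?u) \<noteq> 0" by (simp del: mult_pCons_left)
        moreover have "poly (?a * (pderiv ?u * pderiv ?u)) t \<ge> 0" if "t \<in> {-1..1}" for t
          unfolding poly_mult using that one_minus_square_nonneg
          by (intro mult_nonneg_nonneg zero_le_square) auto
        ultimately show False using pint_pos[of "?a * (pderiv ?u * pderiv ?u)"] 0 by simp
      qed
    qed (simp add: pint_0)
    then show ?thesis
      using diss_form_modal[OF u u, of ?a] Modal_Legendre by (simp add: constant_iff_pderiv_zero)
  qed
qed

text \<open>By symmetry the form of \<open>A^(2j)\<close> is the squared norm of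
  \<open>A^j u\<close>, and that of \<open>A^(2j+1)\<close> is the form of \<open>A\<close> at
  \<open>A^j u\<close>. Both are nonnegative, and a zero value descends to a smaller exponent until
  \<open>A u = 0\<close>.\<close>

lemma iterated_form_pos_iff:
  assumes b: "valid_basis N b" and A: "A \<in> carrier_mat (N + 1) (N + 1)"
    and sym: "\<And>u v. u \<in> carrier_vec (N + 1) \<Longrightarrow> v \<in> carrier_vec (N + 1) \<Longrightarrow>
      ip_M N b u (A *\<^sub>v v) = ip_M N b v (A *\<^sub>v u)"
    and nonneg: "\<And>u. u \<in> carrier_vec (N + 1) \<Longrightarrow> ip_M N b u (A *\<^sub>v u) \<ge> 0"
    and u: "u \<in> carrier_vec (N + 1)" and s: "s \<ge> 1"
  shows "ip_M N b u ((A ^\<^sub>m s) *\<^sub>v u) > 0 \<longleftrightarrow> ip_M N b u (A *\<^sub>v u) \<noteq> 0"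
proof -
  let ?C = "carrier_vec (N + 1) :: real vec set"
  define f where "f v = A *\<^sub>v v" for v
  have f: "f v \<in> ?C" if "v \<in> ?C" for v
    using A that by (simp add: f_def)
  have it: "(f ^^ k) u \<in> ?C" for k
    by (induction k) (use u f in auto)
  have pow: "(A ^\<^sub>m k) *\<^sub>v v = (f ^^ k) v" if "v \<in> ?C" for k v
    using that
  proof (induction k arbitrary: v)
    case 0
    then show ?case using A by simp
  next
    case (Suc k)
    have "(A ^\<^sub>m k * A) *\<^sub>v v = (A ^\<^sub>m k) *\<^sub>v f v"
      unfolding f_def using A Suc.prems
      by (intro assoc_mult_mat_vec[of _ "N + 1" "N + 1" _ "N + 1"]) auto
    then show ?case using Suc.IH[OF f[OF Suc.prems]] by (simp add: funpow_swap1)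
  qed
  \<comment> \<open>Null vectors of a positive semidefinite form lie in its kernel: perturb
    \<open>v\<close> along \<open>f v\<close> and use nonnegativity of the form.\<close>
  have null: "f v = 0\<^sub>v (N + 1)" if v: "v \<in> ?C" and 0: "ip_M N b v (f v) = 0" for v
  proof (rule norm2_M_eq_0[OF b f[OF v]])
    define n c where "n = norm2_M N b (f v)" and "c = ip_M N b (f v) (f (f v))"
    have c: "c \<ge> 0" unfolding c_def f_def using nonneg[of "A *\<^sub>v v"] f[OF v] by (simp add: f_def)
    \<comment> \<open>The denominator \<open>c + 1\<close> rather than \<open>c\<close> avoids a
      case split at \<open>c = 0\<close>; the perturbed form times \<open>(c + 1)^2\<close> is then
      \<open>- n^2 (c + 2)\<close>.\<close>
    define t where "t = - n / (c + 1)"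
    have t: "t * (c + 1) = - n" using c by (simp add: t_def)
    have tv: "t \<cdot>\<^sub>v f v \<in> ?C" using f[OF v] by simp
    have "f (v + t \<cdot>\<^sub>v f v) = f v + t \<cdot>\<^sub>v f (f v)"
      unfolding f_def using A v f[OF v]
      by (simp add: mult_add_distrib_mat_vec[of _ "Suc N" "Suc N"] mult_mat_vec[of _ "Suc N" "Suc N"])
    then have "0 \<le> ip_M N b (v + t \<cdot>\<^sub>v f v) (f v + t \<cdot>\<^sub>v f (f v))"
      using nonneg[of "v + t \<cdot>\<^sub>v f v"] v tv by (simp add: f_def)
    also have "\<dots> = 2 * t * n + t\<^sup>2 * c"
      using v f[OF v] f[OF f[OF v]] 0 sym[of v "f v"]
      by (simp add: ip_M_add_left ip_M_add_right ip_M_smult_left ip_M_smult_right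
          n_def c_def norm2_M_def power2_eq_square f_def distrib_left)
    finally have "0 \<le> (2 * t * n + t\<^sup>2 * c) * (c + 1)\<^sup>2" by simp
    also have "\<dots> = 2 * n * (t * (c + 1)) * (c + 1) + (t * (c + 1))\<^sup>2 * c"
      by (simp add: power2_eq_square algebra_simps)
    also have "\<dots> = - (n\<^sup>2 * (c + 2))"
      unfolding t by (simp add: power2_eq_square algebra_simps)
    finally have "n\<^sup>2 * (c + 2) \<le> 0" by simp
    then have "n = 0" using c by (simp add: mult_le_0_iff)
    then show "norm2_M N b (f v) = 0" by (simp add: n_def)
  qed
  have shift: "ip_M N b u ((f ^^ (j + k)) u) = ip_M N b ((f ^^ j) u) ((f ^^ k) u)" for j k
  proof (induction j arbitrary: k)
    case (Suc j)
    have "ip_M N b u ((f ^^ (Suc j + k)) u) = ip_M N b ((f ^^ j) u) (f ((f ^^ k) u))"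
      using Suc[of "Suc k"] by simp
    also have "\<dots> = ip_M N b (f ((f ^^ j) u)) ((f ^^ k) u)"
      using sym[OF it[of j] it[of k]] ip_M_commute[OF f[OF it[of j]] it[of k]] by (simp add: f_def)
    finally show ?case by simp
  qed simp
  have f0: "f (0\<^sub>v (N + 1)) = 0\<^sub>v (N + 1)"
    unfolding f_def using A by (intro eq_vecI) (auto intro: scalar_prod_right_zero row_carrier_vec)
  have main: "ip_M N b u ((f ^^ k) u) \<ge> 0 \<and>
      (ip_M N b u ((f ^^ k) u) = 0 \<longrightarrow> f u = 0\<^sub>v (N + 1))" if "k \<ge> 1" for k
    using that
  proof (induction k rule: less_induct)
    case (less k)
    \<comment> \<open>The exponent 1 stands apart: with \<open>j = 0\<close> the odd case would
      refer to the induction hypothesis at \<open>Suc j = k\<close> itself.\<close>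
    consider "k = 1" | j where "k = j + j" "j \<ge> 1" | j where "k = j + Suc j" "j \<ge> 1"
    proof (cases "even k")
      case True
      then obtain j where "k = 2 * j" ..
      then show thesis using less.prems that(2)[of j] by simp
    next
      case False
      then obtain j where "k = 2 * j + 1" ..
      then show thesis using that(1) that(3)[of j] by (cases "j = 0") simp_all
    qed
    then show ?case
    proof cases
      case 1
      then show ?thesis using nonneg[OF u] null[OF u] by (simp add: f_def)
    next
      case 2
      have eq: "ip_M N b u ((f ^^ k) u) = norm2_M N b ((f ^^ j) u)"
        unfolding 2 shift norm2_M_def ..
      have "f u = 0\<^sub>v (N + 1)" if "norm2_M N b ((f ^^ j) u) = 0"
        using norm2_M_eq_0[OF b it that] less.IH[of j] 2 ip_M_zero_right[OF u] by simp
      then show ?thesis unfolding eq using norm2_M_nonneg[OF b it] by blast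
    next
      case 3
      have eq: "ip_M N b u ((f ^^ k) u) = ip_M N b ((f ^^ j) u) (f ((f ^^ j) u))"
        unfolding 3 shift by simp
      have "f u = 0\<^sub>v (N + 1)" if "ip_M N b ((f ^^ j) u) (f ((f ^^ j) u)) = 0"
        using null[OF it that] less.IH[of "Suc j"] 3 ip_M_zero_right[OF u] by simp
      then show ?thesis unfolding eq using nonneg[OF it[of j]] by (simp add: f_def)
    qed
  qed
  \<comment> \<open>The converse: once \<open>f u\<close> is zero, so are all further
    iterates.\<close>
  have "ip_M N b u ((f ^^ s) u) = 0" if "ip_M N b u (f u) = 0"
  proof -
    obtain k where k: "s = Suc k" using s by (cases s) auto
    have "(f ^^ k) (0\<^sub>v (N + 1)) = 0\<^sub>v (N + 1)" for k by (induction k) (use f0 in simp_all)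
    then show ?thesis
      using null[OF u that] ip_M_zero_right[OF u] by (simp add: k funpow_swap1)
  qed
  then show ?thesis
    using main[OF s] ip_M_zero_right[OF u, of b] unfolding pow[OF u] f_def[symmetric] by fastforce
qed

text \<open>Multiply by \<open>4 * X\<close> and complete the square.\<close>

lemma quadratic_le_0_iff:
  fixes X Y Z e :: real
  assumes X: "X > 0" and D: "Y\<^sup>2 - 4 * X * Z > 0"
  shows "e\<^sup>2 * X + e * Y + Z \<le> 0 \<longleftrightarrow>
    1 / (2 * X) * (- Y - sqrt (Y\<^sup>2 - 4 * X * Z)) \<le> e \<and> e \<le> 1 / (2 * X) * (- Y + sqrt (Y\<^sup>2 - 4 * X * Z))"
proof -
  let ?D = "Y\<^sup>2 - 4 * X * Z"
  have "e\<^sup>2 * X + e * Y + Z \<le> 0 \<longleftrightarrow> 4 * X * (e\<^sup>2 * X + e * Y + Z) \<le> 0"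
    using X by (simp add: mult_le_0_iff)
  also have "4 * X * (e\<^sup>2 * X + e * Y + Z) = (2 * X * e + Y)\<^sup>2 - ?D"
    by (simp add: power2_eq_square algebra_simps)
  also have "\<dots> \<le> 0 \<longleftrightarrow> \<bar>2 * X * e + Y\<bar> \<le> sqrt ?D"
    by (metis diff_le_0_iff_le real_sqrt_abs real_sqrt_le_iff)
  also have "\<dots> \<longleftrightarrow> - Y - sqrt ?D \<le> 2 * X * e \<and> 2 * X * e \<le> - Y + sqrt ?D" by linarith
  also have "\<dots> \<longleftrightarrow> 1 / (2 * X) * (- Y - sqrt ?D) \<le> e \<and> e \<le> 1 / (2 * X) * (- Y + sqrt ?D)"
    using X by (simp add: field_simps)
  finally show ?thesis .
qed

section \<open>The Euler step\<close>

lemma ddt_carrier: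
  assumes "sbp_fr_method S"
  shows "ddt S U i \<in> carrier_vec (deg S + 1)"
  using assms by (auto simp: ddt_def Let_def sbp_fr_method_def intro!: carrier_vecI)

lemma diss_carrier:
  assumes "valid_basis (deg S) (basis S)"
  shows "diss S a s u \<in> carrier_vec (deg S + 1)"
  using pow_mat_dim_square(1)[OF diss_mat_carrier[OF assms, of a], of s]
  by (intro carrier_vecI) (simp add: diss_def)

lemma diss_integral_zero:
  assumes b: "valid_basis (deg S) (basis S)" and u: "u \<in> carrier_vec (deg S + 1)" and s: "s \<ge> 1"
  shows "pint (to_poly (deg S) (basis S) (diss S a s u)) = 0"
proof -
  let ?A = "diss_mat (deg S) (basis S) a" and ?n = "deg S + 1"
  have A: "?A \<in> carrier_mat ?n ?n" by (rule diss_mat_carrier[OF b])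
  \<comment> \<open>\<open>pow_mat\<close> multiplies on the right, but the integral is annihilated
    by the outermost \<open>A\<close>, which must therefore stand on the left.\<close>
  have swap: "?A ^\<^sub>m k * ?A = ?A * ?A ^\<^sub>m k" for k
  proof (induction k)
    case 0
    then show ?case using A by simp
  next
    case (Suc k)
    have "?A ^\<^sub>m Suc k * ?A = (?A * ?A ^\<^sub>m k) * ?A" using Suc by simp
    also have "\<dots> = ?A * ?A ^\<^sub>m Suc k"
      using A by (simp add: assoc_mult_mat[of _ ?n ?n _ ?n _ ?n] pow_carrier_mat)
    finally show ?case .
  qed
  obtain k where k: "s = Suc k" using s by (cases s) auto
  have "diss S a s u = ?A *\<^sub>v ((?A ^\<^sub>m k) *\<^sub>v u)"
    unfolding diss_def k pow_mat.simps swap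
    using A u by (intro assoc_mult_mat_vec[of _ ?n ?n _ ?n]) (auto simp: pow_carrier_mat)
  moreover have "(?A ^\<^sub>m k) *\<^sub>v u \<in> carrier_vec ?n"
    using A u by (intro mult_mat_vec_carrier[of _ ?n ?n]) (auto simp: pow_carrier_mat)
  ultimately show ?thesis using diss_mat_integral_zero[OF b] by simp
qed

lemma total_integral_euler_step:
  assumes scheme: "sbp_fr_method S" and b: "valid_basis (deg S) (basis S)"
    and U: "U \<in> states S" and s: "s \<ge> 1"
  shows "total_integral S (euler_step S a s dt eps U)
    = total_integral S U + dt * total_integral S (ddt S U)"
proof -
  have "pint (to_poly (deg S) (basis S) (euler_step S a s dt eps U i))
      = pint (to_poly (deg S) (basis S) (U i)) + dt * pint (to_poly (deg S) (basis S) (ddt S U i))"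
    if "i < elems S" for i
  proof -
    let ?d = "ddt S U i" and ?a = "diss S a s (U i)"
    have u: "U i \<in> carrier_vec (deg S + 1)" using U that by (simp add: states_def)
    note c = u ddt_carrier[OF scheme, of U i] diss_carrier[OF b, of a s "U i"]
    have "?d - eps i \<cdot>\<^sub>v ?a = ?d + (- eps i) \<cdot>\<^sub>v ?a" using c by (intro eq_vecI) auto
    then have "euler_step S a s dt eps U i = U i + dt \<cdot>\<^sub>v (?d + (- eps i) \<cdot>\<^sub>v ?a)"
      by (simp add: euler_step_def)
    moreover have "(- eps i) \<cdot>\<^sub>v ?a \<in> carrier_vec (deg S + 1)"
      "dt \<cdot>\<^sub>v (?d + (- eps i) \<cdot>\<^sub>v ?a) \<in> carrier_vec (deg S + 1)" using c by simp_all
    ultimately show ?thesis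
      using c diss_integral_zero[OF b u s]
      by (simp add: to_poly_add to_poly_smult pint_add pint_diff pint_smult)
  qed
  then show ?thesis
    by (simp add: total_integral_def pint_def[symmetric] sum_distrib_left sum.distrib[symmetric]
        algebra_simps)
qed

text \<open>Expanding the square, everything beyond the semidiscrete estimate carries a factor
  \<open>dt\<close>; the cofactor is the quadratic in the strength that defines \<open>X\<close>,
  \<open>Y\<close> and \<open>Z\<close>.\<close>

lemma norm2_M_euler_step:
  assumes scheme: "sbp_fr_method S" and b: "valid_basis (deg S) (basis S)"
    and u: "U i \<in> carrier_vec (deg S + 1)"
  shows "norm2_M (deg S) (basis S) (euler_step S a s dt eps U i)
    = norm2_M (deg S) (basis S) (U i) + 2 * dt * ip_M (deg S) (basis S) (U i) (ddt S U i)
      + dt * ((eps i)\<^sup>2 * quadX S a s dt U i + eps i * quadY S a s dt U i + quadZ S a s dt U i)"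
proof -
  let ?d = "ddt S U i" and ?a = "diss S a s (U i)"
  note c = u ddt_carrier[OF scheme, of U i] diss_carrier[OF b, of a s "U i"]
  have "?d - eps i \<cdot>\<^sub>v ?a = ?d + (- eps i) \<cdot>\<^sub>v ?a" using c by (intro eq_vecI) auto
  then have "euler_step S a s dt eps U i = U i + dt \<cdot>\<^sub>v (?d + (- eps i) \<cdot>\<^sub>v ?a)"
    by (simp add: euler_step_def)
  moreover have "(- eps i) \<cdot>\<^sub>v ?a \<in> carrier_vec (deg S + 1)" "?d + (- eps i) \<cdot>\<^sub>v ?a \<in> carrier_vec (deg S + 1)"
    "dt \<cdot>\<^sub>v (?d + (- eps i) \<cdot>\<^sub>v ?a) \<in> carrier_vec (deg S + 1)" using c by simp_all
  ultimately show ?thesis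
    using c ip_M_commute[of ?d "deg S" "U i" "basis S"] ip_M_commute[of ?a "deg S" "U i" "basis S"]
      ip_M_commute[of ?a "deg S" ?d "basis S"]
    by (simp add: norm2_M_def quadX_def quadY_def quadZ_def ip_M_add_left ip_M_add_right
        ip_M_smult_left ip_M_smult_right power2_eq_square algebra_simps)
qed

text \<open>The strength is bounded on both sides: since \<open>X > 0\<close>, the quadratic is
  positive again beyond its larger root \<open>eps1\<close>. The equivalence shows that both bounds
  are sharp on each element.\<close>

theorem lemma3p1:
  fixes S :: sbp_fr and a :: "real poly" and s :: nat and dt :: real and U :: state
  assumes scheme: "sbp_fr_method S"
    and conservative: "semi_conservative S"
    and stable: "semi_stable S"
    and basis: "valid_basis (deg S) (basis S)"
    and a_nonneg: "\<forall>x\<in>{-1..1}. poly a x \<ge> 0"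
    and a_bdry: "poly a (-1) = 0" "poly a 1 = 0"
    and order: "s \<ge> 1"
    and state: "U \<in> states S"
    and dt: "dt > 0"
  shows
    "(a = [:1, 0, -1:] \<longrightarrow>
       (\<forall>i<elems S.
          ip_M (deg S) (basis S) (U i) (diss S a s (U i)) > 0 \<longleftrightarrow>
          (\<nexists>c. to_poly (deg S) (basis S) (U i) = [:c:]) \<and>
          (is_Lobatto (basis S) \<longrightarrow>
             (\<nexists>c d. to_poly (deg S) (basis S) (U i)
                       = [:c:] + Polynomial.smult d (legendre (deg S)))))) \<and>
     ((\<forall>i<elems S. ip_M (deg S) (basis S) (U i) (diss S a s (U i)) > 0 \<and>
                  discr S a s dt U i > 0 \<and> - quadY S a s dt U i > 0) \<longrightarrow>
       (\<forall>i<elems S. 0 \<le> eps2 S a s dt U i \<and> eps2 S a s dt U i < eps1 S a s dt U i) \<and>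
       (\<forall>eps. (\<forall>i<elems S. eps i > 0) \<longrightarrow>
          step_conservative S a s dt eps U \<and>
          ((\<forall>i<elems S. eps2 S a s dt U i \<le> eps i \<and> eps i \<le> eps1 S a s dt U i) \<longrightarrow>
             step_stable S a s dt eps U) \<and>
          (\<forall>i<elems S. step_stable_on S a s dt eps U i \<longleftrightarrow>
             eps2 S a s dt U i \<le> eps i \<and> eps i \<le> eps1 S a s dt U i)))"
proof (intro conjI impI)
  let ?N = "deg S" and ?b = "basis S"
  have u: "U i \<in> carrier_vec (?N + 1)" if "i < elems S" for i
    using state that by (simp add: states_def)
  {
    assume a: "a = [:1, 0, -1:]"
    have "ip_M ?N ?b (U i) (diss S a s (U i)) > 0 \<longleftrightarrow>
        ip_M ?N ?b (U i) (diss_mat ?N ?b a *\<^sub>v U i) \<noteq> 0" if "i < elems S" for i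
      unfolding diss_def
      by (rule iterated_form_pos_iff)
         (use basis u[OF that] order diss_mat_carrier diss_form_symmetric
            diss_form_nonneg[OF basis a_nonneg] in auto)
    then show "\<forall>i<elems S.
          ip_M (deg S) (basis S) (U i) (diss S a s (U i)) > 0 \<longleftrightarrow>
          (\<nexists>c. to_poly (deg S) (basis S) (U i) = [:c:]) \<and>
          (is_Lobatto (basis S) \<longrightarrow>
             (\<nexists>c d. to_poly (deg S) (basis S) (U i)
                       = [:c:] + Polynomial.smult d (legendre (deg S))))"
      using diss_form_zero_iff[OF basis u] a by blast
  }
  assume hyp: "\<forall>i<elems S. ip_M (deg S) (basis S) (U i) (diss S a s (U i)) > 0 \<and>
                  discr S a s dt U i > 0 \<and> - quadY S a s dt U i > 0"
  \<comment> \<open>If \<open>A^s u\<close> had norm zero it would be zero, contradicting its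
    positive scalar product with \<open>u\<close>.\<close>
  have X: "quadX S a s dt U i > 0" if "i < elems S" for i
  proof -
    have "norm2_M ?N ?b (diss S a s (U i)) \<noteq> 0"
      using norm2_M_eq_0[OF basis diss_carrier[OF basis]] ip_M_zero_right[OF u[OF that]] hyp that
      by fastforce
    then show ?thesis
      using norm2_M_nonneg[OF basis diss_carrier[OF basis], of a s "U i"] dt
      by (simp add: quadX_def)
  qed
  have Z: "quadZ S a s dt U i \<ge> 0" for i
    using norm2_M_nonneg[OF basis ddt_carrier[OF scheme], of U i] dt by (simp add: quadZ_def)
  show "\<forall>i<elems S. 0 \<le> eps2 S a s dt U i \<and> eps2 S a s dt U i < eps1 S a s dt U i"
  proof (intro allI impI conjI)
    fix i assume i: "i < elems S"
    \<comment> \<open>\<open>X\<close> and \<open>Z\<close> are nonnegative, so the discriminant is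
      at most \<open>Y^2\<close>, and \<open>- Y > 0\<close> turns the absolute value of
      \<open>Y\<close> into \<open>- Y\<close>.\<close>
    have "sqrt (discr S a s dt U i) \<le> sqrt ((quadY S a s dt U i)\<^sup>2)"
      using X[OF i] Z[of i] by (intro real_sqrt_le_mono) (simp add: discr_def)
    then have "sqrt (discr S a s dt U i) \<le> - quadY S a s dt U i"
      using hyp i by auto
    then show "0 \<le> eps2 S a s dt U i" using X[OF i] by (simp add: eps2_def)
    show "eps2 S a s dt U i < eps1 S a s dt U i"
      unfolding eps1_def eps2_def using X[OF i] hyp i
      by (intro mult_strict_left_mono) auto
  qed
  have on: "step_stable_on S a s dt eps U i \<longleftrightarrow>
      eps2 S a s dt U i \<le> eps i \<and> eps i \<le> eps1 S a s dt U i" if i: "i < elems S" for i eps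
  proof -
    have "step_stable_on S a s dt eps U i \<longleftrightarrow>
      dt * ((eps i)\<^sup>2 * quadX S a s dt U i + eps i * quadY S a s dt U i + quadZ S a s dt U i) \<le> 0"
      unfolding step_stable_on_def norm2_M_euler_step[where U = U, OF scheme basis u[OF i]] by linarith
    also have "\<dots> \<longleftrightarrow>
      (eps i)\<^sup>2 * quadX S a s dt U i + eps i * quadY S a s dt U i + quadZ S a s dt U i \<le> 0"
      using dt by (simp add: mult_le_0_iff)
    also have "\<dots> \<longleftrightarrow> eps2 S a s dt U i \<le> eps i \<and> eps i \<le> eps1 S a s dt U i"
      unfolding eps1_def eps2_def discr_def
      by (rule quadratic_le_0_iff[OF X[OF i]]) (use hyp i in \<open>simp add: discr_def\<close>)
    finally show ?thesis .
  qed
  \<comment> \<open>Neither the semidiscretisation nor the dissipation changes the total integral,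
    whatever the strengths.\<close>
  have "step_conservative S a s dt eps U" for eps
    using total_integral_euler_step[OF scheme basis state order] conservative state
    by (simp add: step_conservative_def semi_conservative_def)
  with on show "\<forall>eps. (\<forall>i<elems S. eps i > 0) \<longrightarrow>
          step_conservative S a s dt eps U \<and>
          ((\<forall>i<elems S. eps2 S a s dt U i \<le> eps i \<and> eps i \<le> eps1 S a s dt U i) \<longrightarrow>
             step_stable S a s dt eps U) \<and>
          (\<forall>i<elems S. step_stable_on S a s dt eps U i \<longleftrightarrow>
             eps2 S a s dt U i \<le> eps i \<and> eps i \<le> eps1 S a s dt U i)"
    by (simp add: step_stable_def)
qed

end
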